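(* Let $\alpha>0$ be a constant independent of $n$, let $m=\alpha n$, and let $H$ be an $m\times n$ matrix with i.i.d. standard normal components. Let $$\xi_p=\max_{x\in\{-\frac{1}{\sqrt n},\frac{1}{\sqrt n}\}^n,\ y\in\{-\frac{1}{\sqrt m},\frac{1}{\sqrt m}\}^m} y^T H x .$$ Let $\epsilon_1^{(m)},\epsilon_1^{(n)},\epsilon_5^{(g)}$ be arbitrarily small positive constants independent of $n$ and let $\xi_p^{(u)}$ be a scalar such that $$(1+\epsilon_1^{(m)})\sqrt{\alpha}\sqrt{\frac{2}{\pi}}+(1+\epsilon_1^{(n)})\sqrt{\frac{2}{\pi}}+\epsilon_5^{(g)}<\frac{\xi_p^{(u)}}{\sqrt n}.$$ Then $$\lim_{n\to\infty}P(\xi_p\le \xi_p^{(u)})=1,\qquad\text{equivalently}\qquad \lim_{n\to\infty}P\big(\xi_p^2\le (\xi_p^{(u)})^2\big)=1,$$ and $$\frac{E\xi_p}{\sqrt n}\ \le\ (\sqrt{\alpha}+1)\sqrt{\frac{2}{\pi}}.$$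
   Context: The scalar $\xi_p^{(u)}=\xi_p^{(u)}(n)$ may depend on $n$ and satisfies the displayed inequality for every $n$ considered. The limits are taken along positive integers $n$ for which $m=\alpha n$ is an integer. $P$ and $E$ denote probability and expectation. *)

theory Defs
  imports "HOL-Probability.Probability"
begin

text \<open>
  Vectors of length \<open>n\<close> are functions on \<open>{..<n}\<close> (extended by \<open>undefined\<close>), since the
  dimensions vary with the limit index.
\<close>

definition cube :: "nat \<Rightarrow> (nat \<Rightarrow> real) set" where
  "cube n = {..<n} \<rightarrow>\<^sub>E {- 1 / sqrt (real n), 1 / sqrt (real n)}"

definition bilin :: "nat \<Rightarrow> nat \<Rightarrow> (nat \<Rightarrow> nat \<Rightarrow> real) \<Rightarrow> (nat \<Rightarrow> real) \<Rightarrow> (nat \<Rightarrow> real) \<Rightarrow> real" where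
  "bilin m n H x y = (\<Sum>i<m. y i * (\<Sum>j<n. H i j * x j))"

text \<open>The set is finite and nonempty for all \<open>m\<close> and \<open>n\<close>, so \<open>Max\<close> is a true maximum.\<close>

definition xi_p :: "nat \<Rightarrow> nat \<Rightarrow> (nat \<Rightarrow> nat \<Rightarrow> real) \<Rightarrow> real" where
  "xi_p m n H = Max {bilin m n H x y | x y. x \<in> cube n \<and> y \<in> cube m}"

text \<open>The random matrix is given by its entries: \<open>H i j\<close> is a random variable on \<open>M\<close>.\<close>

definition iid_std_normal_matrix ::
    "'a measure \<Rightarrow> nat \<Rightarrow> nat \<Rightarrow> (nat \<Rightarrow> nat \<Rightarrow> 'a \<Rightarrow> real) \<Rightarrow> bool" where
  "iid_std_normal_matrix M m n H \<longleftrightarrow>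
     prob_space M \<and>
     prob_space.indep_vars M (\<lambda>_. borel) (\<lambda>(i, j). H i j) ({..<m} \<times> {..<n}) \<and>
     (\<forall>i<m. \<forall>j<n. distributed M lborel (H i j) std_normal_density)"

definition admissible :: "real \<Rightarrow> nat set" where
  "admissible \<alpha> = {n. 0 < n \<and> \<alpha> * real n \<in> \<int>}"

text \<open>
  Passing to infinity inside \<open>admissible \<alpha>\<close>. For irrational \<open>\<alpha>\<close> there are no admissible \<open>n\<close>
  and the filter is \<open>bot\<close>.
\<close>

definition admissible_at_top :: "real \<Rightarrow> nat filter" where
  "admissible_at_top \<alpha> = inf sequentially (principal (admissible \<alpha>))"

end

theory Submission
  imports Defs "HOL-Real_Asymp.Real_Asymp"
begin

text \<open>
  Chevet's comparison at the level of exponential moments. For unit vectors the Gaussian process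
  \<open>X(x, y) = y\<^sup>T H x + \<gamma>\<close>, with an independent standard normal \<open>\<gamma>\<close>, has the same variances as
  \<open>Y(x, y) = g\<^sup>T y + h\<^sup>T x\<close>, and its covariances exceed those of \<open>Y\<close> by
  \<open>(1 - \<langle>x, x'\<rangle>) (1 - \<langle>y, y'\<rangle>) \<ge> 0\<close>. The function \<open>F(z) = (\<Sum>\<^sub>i exp (\<beta> z\<^sub>i))\<^sup>p\<close> with \<open>0 < p \<le> 1\<close> has
  nonpositive mixed second derivatives, so \<open>E F(sin \<theta> X + cos \<theta> Y)\<close> decreases in \<open>\<theta>\<close> by Gaussian
  integration by parts. Fixing \<open>\<beta> p = t\<close> and letting \<open>p \<rightarrow> 0\<close> gives
  \<open>E exp (t max X) \<le> E exp (t max Y)\<close>. The right-hand side is a product of moment generating functions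
  of \<open>|g\<^sub>i| / \<surd>m\<close> and \<open>|h\<^sub>j| / \<surd>n\<close>, hence at most
  \<open>exp (t \<surd>(2/\<pi>) (\<surd>m + \<surd>n) + O(t\<^sup>2))\<close> for \<open>t \<le> 1\<close>, with a constant independent of \<open>m\<close> and \<open>n\<close>.
  Letting \<open>t \<rightarrow> 0\<close> bounds the expectation, and \<open>t = 1\<close> with Markov's inequality gives the
  probability bound.
\<close>

section \<open>Gaussian integration by parts\<close>

definition std_gauss :: "real measure" where
  "std_gauss = density lborel std_normal_density"

lemma sets_std_gauss [measurable_cong, simp]: "sets std_gauss = sets borel"
  by (simp add: std_gauss_def)

interpretation std_gauss: prob_space std_gauss
  unfolding std_gauss_def by (rule prob_space_normal_density) simp

lemma integral_std_gauss:
  fixes f :: "real \<Rightarrow> real"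
  assumes "f \<in> borel_measurable borel"
  shows "(\<integral>x. f x \<partial>std_gauss) = (\<integral>x. std_normal_density x * f x \<partial>lborel)"
  using assms by (simp add: std_gauss_def integral_density)

lemma integrable_std_gauss_iff:
  fixes f :: "real \<Rightarrow> real"
  assumes "f \<in> borel_measurable borel"
  shows "integrable std_gauss f \<longleftrightarrow> integrable lborel (\<lambda>x. std_normal_density x * f x)"
  using assms by (simp add: std_gauss_def integrable_density)

lemma integral_abs_std_gauss: "(\<integral>x. \<bar>x\<bar> \<partial>std_gauss) = sqrt (2 / pi)"
  using integral_std_normal_moment_abs_odd[of 0] by (simp add: integral_std_gauss)

text \<open>Completing the square in the exponent: an exponential tilt of the standard normal
  density is a shifted normal density up to a constant, hence integrable.\<close>

lemma std_normal_density_exp: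
  "std_normal_density x * exp (c * x) = exp (c\<^sup>2 / 2) * normal_density c 1 x"
  by (simp add: normal_density_def field_simps power2_diff flip: exp_add)

lemma exp_abs_le: "exp (c * \<bar>x\<bar>) \<le> exp (c * x) + exp (- c * x)" for c x :: real
  by (cases "x \<ge> 0") (auto simp: add_increasing add_increasing2)

lemma integrable_exp_abs_std_gauss: "integrable std_gauss (\<lambda>x. exp (c * \<bar>x\<bar>))"
proof (rule Bochner_Integration.integrable_bound)
  have "integrable std_gauss (\<lambda>x. exp (c * x))" for c
    by (subst integrable_std_gauss_iff) (auto simp: std_normal_density_exp)
  from Bochner_Integration.integrable_add[OF this[of c] this[of "- c"]]
  show "integrable std_gauss (\<lambda>x. exp (c * x) + exp (- c * x))" .
qed (use exp_abs_le in \<open>auto intro: order_trans\<close>)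

text \<open>Stein's identity. The derivative of \<open>f\<close> times the density is the density
  times \<open>f' x - x * f x\<close>; its integral over the line is zero because the product
  vanishes at both ends. Exponential growth of \<open>f\<close> and \<open>f'\<close> gives that
  decay and the integrability.\<close>

lemma std_gauss_integration_by_parts:
  fixes f f' :: "real \<Rightarrow> real"
  assumes deriv: "\<And>x. (f has_real_derivative f' x) (at x)"
    and cont: "continuous_on UNIV f'"
    and f: "\<And>x. \<bar>f x\<bar> \<le> C * exp (c * \<bar>x\<bar>)"
    and f': "\<And>x. \<bar>f' x\<bar> \<le> C * exp (c * \<bar>x\<bar>)"
  shows "(\<integral>x. x * f x \<partial>std_gauss) = (\<integral>x. f' x \<partial>std_gauss)"
proof -
  have contf: "continuous_on UNIV f"
    using deriv by (meson DERIV_isCont continuous_at_imp_continuous_on)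
  have meas [measurable]: "f \<in> borel_measurable borel" "f' \<in> borel_measurable borel"
    using cont contf by (auto intro: borel_measurable_continuous_onI)
  have int_f': "integrable std_gauss f'"
    by (rule Bochner_Integration.integrable_bound
          [OF integrable_mult_right[OF integrable_exp_abs_std_gauss[of c], of C]])
       (auto intro!: order_trans[OF f'] abs_ge_self)
  have int_xf: "integrable std_gauss (\<lambda>x. x * f x)"
  proof (rule Bochner_Integration.integrable_bound
          [OF integrable_mult_right[OF integrable_exp_abs_std_gauss[of "c + 1"], of C]])
    have "\<bar>x * f x\<bar> \<le> \<bar>C * exp ((c + 1) * \<bar>x\<bar>)\<bar>" for x
    proof -
      have "\<bar>x\<bar> \<le> exp \<bar>x\<bar>"
        by (rule order_trans[OF _ exp_ge_add_one_self]) simp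
      then have "\<bar>x\<bar> * \<bar>f x\<bar> \<le> exp \<bar>x\<bar> * (C * exp (c * \<bar>x\<bar>))"
        by (intro mult_mono f) auto
      also have "\<dots> = C * exp ((c + 1) * \<bar>x\<bar>)"
        by (simp add: algebra_simps exp_add)
      finally have "\<bar>x * f x\<bar> \<le> C * exp ((c + 1) * \<bar>x\<bar>)"
        by (simp add: abs_mult)
      then show ?thesis
        by linarith
    qed
    then show "AE x in std_gauss. norm (x * f x) \<le> norm (C * exp ((c + 1) * \<bar>x\<bar>))"
      by simp
  qed simp
  define F where "F x = f x * std_normal_density x" for x
  define F' where "F' x = std_normal_density x * f' x - std_normal_density x * (x * f x)" for x
  have D: "(F has_real_derivative F' x) (at x)" for x
    unfolding F_def F'_def std_normal_density_def
    by (rule derivative_eq_intros deriv refl | simp add: field_simps)+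
  have int: "integrable lborel F'"
    using int_f' int_xf unfolding F'_def by (simp add: integrable_std_gauss_iff)
  \<comment> \<open>Half of the Gaussian exponent pays for the growth of \<open>f\<close>:
    \<open>(c - \<bar>x\<bar> / 2)\<^sup>2\<close> being nonnegative bounds
    \<open>c * \<bar>x\<bar>\<close> by \<open>c\<^sup>2 + x\<^sup>2 / 4\<close>.\<close>
  have bound: "\<bar>F x\<bar> \<le> \<bar>C\<bar> * exp (c\<^sup>2) * exp (- x\<^sup>2 / 4)" for x
  proof -
    have "\<bar>F x\<bar> \<le> C * exp (c * \<bar>x\<bar>) * exp (- x\<^sup>2 / 2)"
    proof -
      have "std_normal_density x \<le> exp (- x\<^sup>2 / 2)"
        using pi_gt3 unfolding std_normal_density_def by (intro mult_left_le_one_le) (auto simp: divide_le_eq)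
      then show ?thesis
        using f[of x] unfolding F_def abs_mult by (intro mult_mono) auto
    qed
    also have "\<dots> = C * exp (c * \<bar>x\<bar> - x\<^sup>2 / 2)"
      by (simp flip: exp_add)
    also have "\<dots> \<le> \<bar>C\<bar> * exp (c\<^sup>2 - x\<^sup>2 / 4)"
    proof (rule mult_mono)
      have "0 \<le> (c - \<bar>x\<bar> / 2)\<^sup>2"
        by simp
      also have "\<dots> = c\<^sup>2 - c * \<bar>x\<bar> + x\<^sup>2 / 4"
        by (simp add: power2_diff power_divide)
      finally show "exp (c * \<bar>x\<bar> - x\<^sup>2 / 2) \<le> exp (c\<^sup>2 - x\<^sup>2 / 4)"
        by simp
    qed auto
    also have "\<dots> = \<bar>C\<bar> * exp (c\<^sup>2) * exp (- x\<^sup>2 / 4)"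
      by (simp flip: exp_add)
    finally show ?thesis .
  qed
  have "((\<lambda>x::real. \<bar>C\<bar> * exp (c\<^sup>2) * exp (- x\<^sup>2 / 4)) \<longlongrightarrow> 0) at_top"
    "((\<lambda>x::real. \<bar>C\<bar> * exp (c\<^sup>2) * exp (- x\<^sup>2 / 4)) \<longlongrightarrow> 0) at_bot"
    by (rule tendsto_mult_right_zero, real_asymp)+
  then have lim: "(F \<longlongrightarrow> 0) at_top" "(F \<longlongrightarrow> 0) at_bot"
    by (auto elim!: Lim_null_comparison[rotated] intro!: always_eventually simp: bound[simplified])
  have "isCont F' x" for x
    using cont contf unfolding F'_def std_normal_density_def
    by (auto intro!: continuous_intros simp: continuous_on_eq_continuous_at)
  then have "(LBINT x=-\<infinity>..\<infinity>. F' x) = 0 - 0"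
    by (intro interval_integral_FTC_integrable[where F = F])
       (use D int lim in \<open>auto simp: ereal_tendsto_simps set_integrable_def
          has_real_derivative_iff_has_vector_derivative\<close>)
  then have "(\<integral>x. F' x \<partial>lborel) = 0"
    by (simp add: interval_lebesgue_integral_def set_lebesgue_integral_def)
  then show ?thesis
    using int_f' int_xf unfolding F'_def
    by (simp add: integral_std_gauss integrable_std_gauss_iff)
qed

section \<open>Vectors of independent standard normal coordinates\<close>

definition gauss_vec :: "'k set \<Rightarrow> ('k \<Rightarrow> real) measure" where
  "gauss_vec K = Pi\<^sub>M K (\<lambda>_. std_gauss)"

lemma measurable_gauss_vec_component:
  "k \<in> K \<Longrightarrow> (\<lambda>x. x k) \<in> borel_measurable (gauss_vec K)"
  unfolding gauss_vec_def by measurable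

lemma product_sigma_finite_std_gauss: "product_sigma_finite (\<lambda>_. std_gauss)"
  by standard

lemma integrable_exp_sum_abs_gauss_vec:
  assumes "finite K"
  shows "integrable (gauss_vec K) (\<lambda>x. exp (\<Sum>k\<in>K. w k * \<bar>x k\<bar>))"
  unfolding gauss_vec_def exp_sum[OF assms]
  by (intro product_sigma_finite.product_integrable_prod product_sigma_finite_std_gauss assms
      integrable_exp_abs_std_gauss)

lemma integral_exp_sum_abs_gauss_vec:
  assumes "finite K"
  shows "(\<integral>x. exp (\<Sum>k\<in>K. w k * \<bar>x k\<bar>) \<partial>gauss_vec K) = (\<Prod>k\<in>K. \<integral>y. exp (w k * \<bar>y\<bar>) \<partial>std_gauss)"
  unfolding gauss_vec_def exp_sum[OF assms]
  by (intro product_sigma_finite.product_integral_prod product_sigma_finite_std_gauss assms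
      integrable_exp_abs_std_gauss)

text \<open>Exponential growth in the l1 norm is the common integrability criterion below: the
  dominating function is a product over the coordinates.\<close>

lemma integrable_gauss_vec_exp_bound:
  fixes f :: "('k \<Rightarrow> real) \<Rightarrow> real"
  assumes "finite K" "f \<in> borel_measurable (gauss_vec K)"
    and f: "\<And>x. \<bar>f x\<bar> \<le> C * exp (c * (\<Sum>k\<in>K. \<bar>x k\<bar>))"
  shows "integrable (gauss_vec K) f"
proof (rule Bochner_Integration.integrable_bound)
  show "integrable (gauss_vec K) (\<lambda>x. C * exp (c * (\<Sum>k\<in>K. \<bar>x k\<bar>)))"
    using integrable_exp_sum_abs_gauss_vec[OF assms(1), of "\<lambda>_. c"] by (simp add: sum_distrib_left)
  show "AE x in gauss_vec K. norm (f x) \<le> norm (C * exp (c * (\<Sum>k\<in>K. \<bar>x k\<bar>)))"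
    unfolding real_norm_def by (intro AE_I2 order_trans[OF f] abs_ge_self)
qed fact

text \<open>A coordinate is at most the l1 norm and thus at most its exponential, so multiplying by
  it only raises the rate \<open>c\<close> by one.\<close>

lemma mult_component_exp_bound:
  fixes x :: "'k \<Rightarrow> real"
  assumes "finite K" "k \<in> K" "\<bar>y\<bar> \<le> C * exp (c * (\<Sum>k\<in>K. \<bar>x k\<bar>))"
  shows "\<bar>x k * y\<bar> \<le> C * exp ((c + 1) * (\<Sum>k\<in>K. \<bar>x k\<bar>))"
proof -
  define S where "S = (\<Sum>k\<in>K. \<bar>x k\<bar>)"
  have "\<bar>x k\<bar> \<le> S"
    unfolding S_def using assms(1,2) by (intro member_le_sum) auto
  also have "\<dots> \<le> exp S"
    by (rule order_trans[OF _ exp_ge_add_one_self]) simp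
  finally have "\<bar>x k\<bar> * \<bar>y\<bar> \<le> exp S * (C * exp (c * S))"
    by (rule mult_mono[OF _ assms(3)[folded S_def]]) auto
  also have "\<dots> = C * exp ((c + 1) * S)"
    by (simp add: algebra_simps exp_add)
  finally show ?thesis
    unfolding S_def by (simp only: abs_mult)
qed

text \<open>Fubini isolates the coordinate \<open>k\<close>; the one-dimensional identity is applied
  with all other coordinates frozen.\<close>

lemma gauss_vec_integration_by_parts:
  fixes f f' :: "('k \<Rightarrow> real) \<Rightarrow> real"
  assumes K: "finite K" "k \<in> K"
    and meas [measurable]: "f \<in> borel_measurable (gauss_vec K)" "f' \<in> borel_measurable (gauss_vec K)"
    and deriv: "\<And>x s. ((\<lambda>s. f (x(k := s))) has_real_derivative f' (x(k := s))) (at s)"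
    and cont: "\<And>x. continuous_on UNIV (\<lambda>s. f' (x(k := s)))"
    and f: "\<And>x. \<bar>f x\<bar> \<le> C * exp (c * (\<Sum>k\<in>K. \<bar>x k\<bar>))"
    and f': "\<And>x. \<bar>f' x\<bar> \<le> C * exp (c * (\<Sum>k\<in>K. \<bar>x k\<bar>))"
  shows "(\<integral>x. x k * f x \<partial>gauss_vec K) = (\<integral>x. f' x \<partial>gauss_vec K)"
proof -
  define J where "J = K - {k}"
  have J: "finite J" "k \<notin> J" and K_eq: "K = insert k J"
    using K by (auto simp: J_def)
  have sum_upd: "(\<Sum>l\<in>K. \<bar>(x(k := s)) l\<bar>) = \<bar>s\<bar> + (\<Sum>l\<in>J. \<bar>x l\<bar>)" for x :: "'k \<Rightarrow> real" and s
  proof -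
    have "(\<Sum>l\<in>J. \<bar>(x(k := s)) l\<bar>) = (\<Sum>l\<in>J. \<bar>x l\<bar>)"
      using J(2) by (intro sum.cong) auto
    then show ?thesis
      using J by (simp add: K_eq)
  qed
  have fold: "(\<integral>x. g x \<partial>gauss_vec K) = (\<integral>x. (\<integral>y. g (x(k := y)) \<partial>std_gauss) \<partial>gauss_vec J)"
    if "integrable (gauss_vec K) g" for g :: "('k \<Rightarrow> real) \<Rightarrow> real"
    unfolding gauss_vec_def K_eq
    by (rule product_sigma_finite.product_integral_insert[OF product_sigma_finite_std_gauss J])
       (fact that[unfolded gauss_vec_def K_eq])
  have "(\<lambda>x. x k * f x) \<in> borel_measurable (gauss_vec K)"
    by (intro borel_measurable_times measurable_gauss_vec_component K(2) meas(1))
  from integrable_gauss_vec_exp_bound[OF K(1) this mult_component_exp_bound[OF K f]]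
  have "(\<integral>x. x k * f x \<partial>gauss_vec K) =
      (\<integral>x. (\<integral>y. y * f (x(k := y)) \<partial>std_gauss) \<partial>gauss_vec J)"
    by (simp only: fold fun_upd_same)
  also have "\<dots> = (\<integral>x. (\<integral>y. f' (x(k := y)) \<partial>std_gauss) \<partial>gauss_vec J)"
  proof (rule Bochner_Integration.integral_cong[OF refl])
    fix x :: "'k \<Rightarrow> real"
    define D where "D = C * exp (c * (\<Sum>l\<in>J. \<bar>x l\<bar>))"
    have D: "C * exp (c * (\<Sum>l\<in>K. \<bar>(x(k := s)) l\<bar>)) = D * exp (c * \<bar>s\<bar>)" for s
      by (simp only: sum_upd D_def distrib_left exp_add mult_ac)
    show "(\<integral>y. y * f (x(k := y)) \<partial>std_gauss) = (\<integral>y. f' (x(k := y)) \<partial>std_gauss)"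
      by (rule std_gauss_integration_by_parts[OF deriv cont f[of "x(k := _)", unfolded D]
            f'[of "x(k := _)", unfolded D]])
  qed
  also have "\<dots> = (\<integral>x. f' x \<partial>gauss_vec K)"
    by (rule fold[symmetric]) (rule integrable_gauss_vec_exp_bound[OF K(1) meas(2) f'])
  finally show ?thesis .
qed

text \<open>Differentiation under the integral sign: by the mean value inequality \<open>w\<close>
  dominates every difference quotient, so dominated convergence applies along each sequence tending
  to \<open>t\<close>.\<close>

lemma has_real_derivative_integral:
  fixes f f' :: "real \<Rightarrow> 'a \<Rightarrow> real"
  assumes int: "\<And>t. integrable M (f t)"
    and meas: "f' t \<in> borel_measurable M"
    and deriv: "\<And>t x. ((\<lambda>t. f t x) has_real_derivative f' t x) (at t)"
    and bound: "\<And>t x. \<bar>f' t x\<bar> \<le> w x"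
    and w: "integrable M w"
  shows "((\<lambda>t. \<integral>x. f t x \<partial>M) has_real_derivative (\<integral>x. f' t x \<partial>M)) (at t)"
  unfolding has_field_derivative_iff tendsto_at_iff_sequentially
proof (intro allI impI)
  fix X :: "nat \<Rightarrow> real"
  assume X: "\<forall>i. X i \<in> UNIV - {t}" "X \<longlonglongrightarrow> t"
  have "(\<lambda>i. \<integral>x. (f (X i) x - f t x) / (X i - t) \<partial>M) \<longlonglongrightarrow> (\<integral>x. f' t x \<partial>M)"
  proof (rule integral_dominated_convergence[where w = w])
    have "(\<lambda>i. (f (X i) x - f t x) / (X i - t)) \<longlonglongrightarrow> f' t x" for x
      using deriv[of x t, unfolded has_field_derivative_iff tendsto_at_iff_sequentially, rule_format, of X] X
      by (simp add: comp_def)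
    then show "AE x in M. (\<lambda>i. (f (X i) x - f t x) / (X i - t)) \<longlonglongrightarrow> f' t x"
      by (rule AE_I2)
    show "AE x in M. norm ((f (X i) x - f t x) / (X i - t)) \<le> w x" for i
    proof (rule AE_I2)
      fix x
      have "norm (f (X i) x - f t x) \<le> w x * norm (X i - t)"
      proof (rule field_differentiable_bound)
        show "((\<lambda>t. f t x) has_field_derivative f' z x) (at z within UNIV)" for z
          by (rule deriv)
        show "norm (f' z x) \<le> w x" for z
          using bound[of z x] by simp
      qed simp_all
      with X(1) show "norm ((f (X i) x - f t x) / (X i - t)) \<le> w x"
        by (simp add: norm_divide divide_le_eq)
    qed
    show "(\<lambda>x. (f (X i) x - f t x) / (X i - t)) \<in> borel_measurable M" for i
      using int[of "X i"] int[of t] by measurable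
  qed (fact meas w)+
  moreover have "(\<integral>x. (f s x - f t x) / (s - t) \<partial>M) = ((\<integral>x. f s x \<partial>M) - (\<integral>x. f t x \<partial>M)) / (s - t)" for s
    by (subst integral_divide_zero) (simp add: Bochner_Integration.integral_diff[OF int int])
  ultimately show "((\<lambda>y. ((\<integral>x. f y x \<partial>M) - (\<integral>x. f t x \<partial>M)) / (y - t)) \<circ> X) \<longlonglongrightarrow> (\<integral>x. f' t x \<partial>M)"
    by (simp only: comp_def)
qed

section \<open>Comparison of Gaussian maxima\<close>

definition lin :: "'k set \<Rightarrow> ('k \<Rightarrow> real) \<Rightarrow> ('k \<Rightarrow> real) \<Rightarrow> real" where
  "lin K v x = (\<Sum>k\<in>K. v k * x k)"

text \<open>A smooth substitute for the maximum: its logarithm divided by \<beta> exceeds the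
  maximum of the linear forms by at most the logarithm of \<open>card I\<close> divided by \<beta>,
  for positive \<beta> and finite nonempty \<open>I\<close>.\<close>

definition expsum :: "'k set \<Rightarrow> 'i set \<Rightarrow> real \<Rightarrow> ('i \<Rightarrow> 'k \<Rightarrow> real) \<Rightarrow> ('k \<Rightarrow> real) \<Rightarrow> real" where
  "expsum K I \<beta> c x = (\<Sum>i\<in>I. exp (\<beta> * lin K (c i) x))"

lemma borel_measurable_lin [measurable]: "lin K v \<in> borel_measurable (gauss_vec K)"
  unfolding lin_def
  by (intro borel_measurable_sum borel_measurable_times borel_measurable_const measurable_gauss_vec_component)

lemma borel_measurable_expsum [measurable]: "expsum K I \<beta> c \<in> borel_measurable (gauss_vec K)"
  unfolding expsum_def by measurable

lemma has_real_derivative_lin_upd: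
  assumes "finite K" "k \<in> K"
  shows "((\<lambda>s. lin K v (x(k := s))) has_real_derivative v k) (at s)"
proof -
  have "((\<lambda>s. \<Sum>l\<in>K. v l * (x(k := s)) l) has_real_derivative (\<Sum>l\<in>K. if l = k then v l else 0)) (at s)"
    by (intro DERIV_sum) (auto intro!: derivative_eq_intros)
  then show ?thesis
    using assms by (simp add: lin_def)
qed

lemma lin_le:
  assumes "\<And>k. k \<in> K \<Longrightarrow> \<bar>v k\<bar> \<le> w k"
  shows "lin K v x \<le> (\<Sum>k\<in>K. w k * \<bar>x k\<bar>)"
  unfolding lin_def
proof (rule sum_mono)
  fix k assume "k \<in> K"
  have "v k * x k \<le> \<bar>v k\<bar> * \<bar>x k\<bar>"
    by (metis abs_ge_self abs_mult)
  also have "\<dots> \<le> w k * \<bar>x k\<bar>"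
    using assms[OF \<open>k \<in> K\<close>] by (rule mult_right_mono) simp
  finally show "v k * x k \<le> w k * \<bar>x k\<bar>" .
qed

text \<open>The bound \<open>B\<close> is a parameter so that a whole family of coefficient systems
  can share one growth estimate; the interpolation below needs bounds uniform along its
  path.\<close>

locale gaussian_softmax =
  fixes K :: "'k set" and I :: "'i set" and \<beta> p B :: real and c :: "'i \<Rightarrow> 'k \<Rightarrow> real"
  assumes finite_K: "finite K" and finite_I: "finite I" and I_nonempty: "I \<noteq> {}"
    and \<beta>: "\<beta> > 0" and p: "0 < p" "p \<le> 1" and B: "0 \<le> B"
    and c_le: "\<And>i k. i \<in> I \<Longrightarrow> k \<in> K \<Longrightarrow> \<bar>c i k\<bar> \<le> B"
begin

abbreviation "e i x \<equiv> exp (\<beta> * lin K (c i) x)"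
abbreviation "S x \<equiv> expsum K I \<beta> c x"

lemma S_pos: "S x > 0"
  unfolding expsum_def using finite_I I_nonempty by (intro sum_pos) auto

lemma e_le_S: "i \<in> I \<Longrightarrow> e i x \<le> S x"
  unfolding expsum_def using finite_I by (intro member_le_sum) auto

lemma S_powr_bound: "S x powr p \<le> real (card I) powr p * exp (p * \<beta> * B * (\<Sum>k\<in>K. \<bar>x k\<bar>))"
proof -
  have "e i x \<le> exp (\<beta> * (B * (\<Sum>k\<in>K. \<bar>x k\<bar>)))" if "i \<in> I" for i
    using lin_le[of K "c i" "\<lambda>_. B" x] c_le[OF that] \<beta> by (simp flip: sum_distrib_left)
  then have "S x \<le> real (card I) * exp (\<beta> * (B * (\<Sum>k\<in>K. \<bar>x k\<bar>)))"
    unfolding expsum_def by (rule sum_bounded_above)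
  then have "S x powr p \<le> (real (card I) * exp (\<beta> * (B * (\<Sum>k\<in>K. \<bar>x k\<bar>)))) powr p"
    using p S_pos[of x] by (intro powr_mono2) auto
  also have "\<dots> = real (card I) powr p * exp (p * \<beta> * B * (\<Sum>k\<in>K. \<bar>x k\<bar>))"
    by (simp add: powr_mult exp_powr_real mult_ac)
  finally show ?thesis .
qed

text \<open>The softmax weight of \<open>i\<close>, the quotient of \<open>e i x\<close> and
  \<open>S x\<close>, is at most 1.\<close>

lemma e_S_powr_le: "i \<in> I \<Longrightarrow> e i x * S x powr (p - 1) \<le> S x powr p"
  using mult_right_mono[OF e_le_S, of i "S x powr (p - 1)" x] S_pos[of x]
  by (simp add: powr_mult_base)

lemma integrable_component_mult:
  assumes "i \<in> I" "k \<in> K"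
  shows "integrable (gauss_vec K) (\<lambda>x. x k * (e i x * S x powr (p - 1)))"
proof (rule integrable_gauss_vec_exp_bound[OF finite_K _ mult_component_exp_bound[OF finite_K assms(2)]])
  show "(\<lambda>x. x k * (e i x * S x powr (p - 1))) \<in> borel_measurable (gauss_vec K)"
    using assms(2) by (intro borel_measurable_times measurable_gauss_vec_component) measurable
  show "\<bar>e i x * S x powr (p - 1)\<bar> \<le> real (card I) powr p * exp (p * \<beta> * B * (\<Sum>k\<in>K. \<bar>x k\<bar>))" for x
    using order_trans[OF e_S_powr_le[OF assms(1)] S_powr_bound, of x] by (simp add: abs_mult)
qed

text \<open>The partial derivative in \<open>x k\<close> of \<open>e i x * S x powr (p - 1)\<close>.
  Up to the factor \<open>p * \<beta>\<close>, the latter is the derivative of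
  \<open>S x powr p\<close> in the value of the form \<open>i\<close>, so this records second
  derivatives of the power of the exponential sum.\<close>

definition grad :: "'i \<Rightarrow> 'k \<Rightarrow> ('k \<Rightarrow> real) \<Rightarrow> real" where
  "grad i k x = \<beta> * (c i k * (e i x * S x powr (p - 1)) -
     (1 - p) * (S x powr (p - 2) * (e i x * (\<Sum>j\<in>I. c j k * e j x))))"

lemma borel_measurable_grad [measurable]: "grad i k \<in> borel_measurable (gauss_vec K)"
  unfolding grad_def by measurable

text \<open>The inner sum over \<open>j\<close> is at most \<open>B * S x\<close> in absolute value,
  so each of the two terms of \<open>grad\<close> is bounded by
  \<open>\<beta> * B * S x powr p\<close>.\<close>

lemma grad_bound:
  assumes i: "i \<in> I" and k: "k \<in> K"
  shows "\<bar>grad i k x\<bar> \<le> 2 * \<beta> * B * S x powr p"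
proof -
  have "\<bar>\<Sum>j\<in>I. c j k * e j x\<bar> \<le> (\<Sum>j\<in>I. \<bar>c j k * e j x\<bar>)"
    by (rule sum_abs)
  also have "\<dots> \<le> (\<Sum>j\<in>I. B * e j x)"
    unfolding abs_mult using c_le k B by (intro sum_mono mult_mono) auto
  also have "\<dots> = B * S x"
    by (simp only: expsum_def sum_distrib_left)
  finally have sum: "\<bar>\<Sum>j\<in>I. c j k * e j x\<bar> \<le> B * S x" .
  have "\<bar>S x powr (p - 2) * (e i x * (\<Sum>j\<in>I. c j k * e j x))\<bar> =
      S x powr (p - 2) * (e i x * \<bar>\<Sum>j\<in>I. c j k * e j x\<bar>)"
    by (simp add: abs_mult)
  also have "\<dots> \<le> S x powr (p - 2) * (S x * (B * S x))"
    using e_le_S[OF i, of x] sum S_pos[of x] by (intro mult_left_mono mult_mono) auto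
  also have "\<dots> = B * S x powr p"
    using S_pos[of x] by (simp add: powr_diff power2_eq_square powr_numeral)
  finally have 2: "\<bar>S x powr (p - 2) * (e i x * (\<Sum>j\<in>I. c j k * e j x))\<bar> \<le> B * S x powr p" .
  have 3: "\<bar>(1 - p) * (S x powr (p - 2) * (e i x * (\<Sum>j\<in>I. c j k * e j x)))\<bar> \<le> 1 * (B * S x powr p)"
    unfolding abs_mult[of "1 - p"] using p by (intro mult_mono 2) auto
  have "\<bar>c i k * (e i x * S x powr (p - 1))\<bar> = \<bar>c i k\<bar> * (e i x * S x powr (p - 1))"
    by (simp add: abs_mult)
  also have "\<dots> \<le> B * S x powr p"
    using c_le[OF i k] e_S_powr_le[OF i, of x] B by (intro mult_mono) auto
  finally have 1: "\<bar>c i k * (e i x * S x powr (p - 1))\<bar> \<le> B * S x powr p" .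
  have "\<bar>grad i k x\<bar> \<le> \<beta> * (B * S x powr p + 1 * (B * S x powr p))"
    unfolding grad_def abs_mult[of \<beta>] abs_of_pos[OF \<beta>]
    by (intro mult_left_mono order_trans[OF abs_triangle_ineq4] add_mono 1 3 less_imp_le[OF \<beta>])
  then show ?thesis
    by (simp add: mult_ac)
qed

lemma grad_exp_bound:
  assumes "i \<in> I" "k \<in> K"
  shows "\<bar>grad i k x\<bar> \<le>
    (2 * \<beta> * B * real (card I) powr p) * exp (p * \<beta> * B * (\<Sum>k\<in>K. \<bar>x k\<bar>))"
  unfolding mult.assoc[of "2 * \<beta> * B"] using \<beta> B
  by (intro order_trans[OF grad_bound[OF assms]] mult_left_mono S_powr_bound) simp

lemma integrable_grad: "i \<in> I \<Longrightarrow> k \<in> K \<Longrightarrow> integrable (gauss_vec K) (grad i k)"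
  by (rule integrable_gauss_vec_exp_bound[OF finite_K borel_measurable_grad grad_exp_bound])

lemma integral_component_mult:
  assumes i: "i \<in> I" and k: "k \<in> K"
  shows "(\<integral>x. x k * (e i x * S x powr (p - 1)) \<partial>gauss_vec K) = (\<integral>x. grad i k x \<partial>gauss_vec K)"
proof (rule gauss_vec_integration_by_parts[OF finite_K k])
  \<comment> \<open>Integration by parts asks for one constant for the function and its derivative:
    1 serves the former, \<open>2 * \<beta> * B\<close> the latter.\<close>
  let ?D = "max 1 (2 * \<beta> * B) * real (card I) powr p"
  show "\<bar>e i x * S x powr (p - 1)\<bar> \<le> ?D * exp (p * \<beta> * B * (\<Sum>k\<in>K. \<bar>x k\<bar>))" for x
  proof -
    have "\<bar>e i x * S x powr (p - 1)\<bar> \<le> 1 * (real (card I) powr p * exp (p * \<beta> * B * (\<Sum>k\<in>K. \<bar>x k\<bar>)))"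
      using order_trans[OF e_S_powr_le[OF i] S_powr_bound, of x] by (simp add: abs_mult)
    also have "\<dots> \<le> max 1 (2 * \<beta> * B) * (real (card I) powr p * exp (p * \<beta> * B * (\<Sum>k\<in>K. \<bar>x k\<bar>)))"
      by (intro mult_right_mono) auto
    finally show ?thesis
      by (simp only: mult.assoc)
  qed
  show "\<bar>grad i k x\<bar> \<le> ?D * exp (p * \<beta> * B * (\<Sum>k\<in>K. \<bar>x k\<bar>))" for x
    by (intro order_trans[OF grad_exp_bound[OF i k]] mult_right_mono) auto
  note lin' = has_real_derivative_lin_upd[OF finite_K k]
  show "((\<lambda>s. e i (x(k := s)) * S (x(k := s)) powr (p - 1)) has_real_derivative grad i k (x(k := s))) (at s)" for x s
  proof -
    have e': "((\<lambda>s. e j (x(k := s))) has_real_derivative \<beta> * (c j k * e j (x(k := s)))) (at s)" for j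
      by (rule derivative_eq_intros lin' refl | simp)+
    have "((\<lambda>s. S (x(k := s))) has_real_derivative (\<Sum>j\<in>I. \<beta> * (c j k * e j (x(k := s))))) (at s)"
      unfolding expsum_def by (intro DERIV_sum e')
    from DERIV_chain2[OF has_real_derivative_powr[OF S_pos, where r = "p - 1"] this]
    have "((\<lambda>s. S (x(k := s)) powr (p - 1)) has_real_derivative
      (p - 1) * S (x(k := s)) powr (p - 2) * (\<beta> * (\<Sum>j\<in>I. c j k * e j (x(k := s))))) (at s)"
      by (rule DERIV_cong) (simp add: sum_distrib_left)
    from DERIV_mult[OF e'[of i] this] show ?thesis
      unfolding grad_def by (rule DERIV_cong) (simp add: algebra_simps)
  qed
  show "continuous_on UNIV (\<lambda>s. grad i k (x(k := s)))" for x
  proof -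
    have lin: "continuous_on UNIV (\<lambda>s. lin K v (x(k := s)))" for v
      by (rule continuous_at_imp_continuous_on) (blast intro: DERIV_isCont lin')
    then have S: "continuous_on UNIV (\<lambda>s. S (x(k := s)))"
      unfolding expsum_def by (intro continuous_intros)
    have "S y \<noteq> 0" for y
      using S_pos[of y] by simp
    with lin S show ?thesis
      unfolding grad_def by (intro continuous_intros) auto
  qed
qed measurable

text \<open>Integration by parts turns each factor \<open>x k\<close> into a derivative and makes
  the inner products of \<open>d i\<close> with \<open>c j\<close> appear. The diagonal ones vanish;
  the others are nonnegative and carry the factor \<open>p - 1\<close>, which is at most 0.\<close>

lemma integral_drift_nonpos:
  assumes diag: "\<And>i. i \<in> I \<Longrightarrow> (\<Sum>k\<in>K. d i k * c i k) = 0"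
    and off: "\<And>i j. i \<in> I \<Longrightarrow> j \<in> I \<Longrightarrow> 0 \<le> (\<Sum>k\<in>K. d i k * c j k)"
  shows "(\<integral>x. (\<Sum>i\<in>I. \<Sum>k\<in>K. d i k * (x k * (e i x * S x powr (p - 1)))) \<partial>gauss_vec K) \<le> 0"
proof -
  have "(\<integral>x. (\<Sum>i\<in>I. \<Sum>k\<in>K. d i k * (x k * (e i x * S x powr (p - 1)))) \<partial>gauss_vec K) =
      (\<Sum>i\<in>I. \<Sum>k\<in>K. d i k * (\<integral>x. x k * (e i x * S x powr (p - 1)) \<partial>gauss_vec K))"
    by (simp add: Bochner_Integration.integral_sum integrable_component_mult)
  also have "\<dots> = (\<Sum>i\<in>I. \<Sum>k\<in>K. d i k * (\<integral>x. grad i k x \<partial>gauss_vec K))"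
    by (simp add: integral_component_mult)
  also have "\<dots> = (\<integral>x. (\<Sum>i\<in>I. \<Sum>k\<in>K. d i k * grad i k x) \<partial>gauss_vec K)"
    by (simp add: Bochner_Integration.integral_sum integrable_grad)
  also have "\<dots> \<le> (\<integral>x. 0 \<partial>gauss_vec K)"
  proof (rule integral_mono)
    show "integrable (gauss_vec K) (\<lambda>x. \<Sum>i\<in>I. \<Sum>k\<in>K. d i k * grad i k x)"
      by (intro Bochner_Integration.integrable_sum integrable_mult_right integrable_grad)
    fix x
    \<comment> \<open>The first term of \<open>grad\<close> only meets the inner product of
      \<open>d i\<close> with \<open>c i\<close>, which \<open>diag\<close> removes; the second
      yields a softmax-type double sum.\<close>
    have inner: "(\<Sum>k\<in>K. d i k * grad i k x) =
        - (\<beta> * (1 - p) * S x powr (p - 2)) * (e i x * (\<Sum>j\<in>I. e j x * (\<Sum>k\<in>K. d i k * c j k)))"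
      if "i \<in> I" for i
    proof -
      have "(\<Sum>k\<in>K. d i k * grad i k x) = \<beta> * (e i x * S x powr (p - 1)) * (\<Sum>k\<in>K. d i k * c i k)
          - (\<beta> * (1 - p) * S x powr (p - 2)) * (e i x * (\<Sum>k\<in>K. \<Sum>j\<in>I. e j x * (d i k * c j k)))"
        unfolding grad_def by (simp add: sum_distrib_left sum_distrib_right sum_subtractf sum.distrib algebra_simps)
      also have "(\<Sum>k\<in>K. \<Sum>j\<in>I. e j x * (d i k * c j k)) = (\<Sum>j\<in>I. e j x * (\<Sum>k\<in>K. d i k * c j k))"
        by (subst sum.swap) (simp add: sum_distrib_left)
      finally show ?thesis
        by (simp add: diag[OF that])
    qed
    show "(\<Sum>i\<in>I. \<Sum>k\<in>K. d i k * grad i k x) \<le> 0"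
    proof (rule sum_nonpos)
      fix i assume "i \<in> I"
      have "0 \<le> e i x * (\<Sum>j\<in>I. e j x * (\<Sum>k\<in>K. d i k * c j k))"
        by (rule mult_nonneg_nonneg[OF _ sum_nonneg[OF mult_nonneg_nonneg]]) (simp_all add: off \<open>i \<in> I\<close>)
      moreover have "0 \<le> \<beta> * (1 - p) * S x powr (p - 2)"
        using \<beta> p by simp
      ultimately show "(\<Sum>k\<in>K. d i k * grad i k x) \<le> 0"
        unfolding inner[OF \<open>i \<in> I\<close>] by (simp only: mult_minus_left neg_le_0_iff_le mult_nonneg_nonneg)
    qed
  qed simp
  finally show ?thesis
    by simp
qed

end

text \<open>Interpolation along a rotation from \<open>b\<close> at angle 0 to \<open>a\<close> at
  angle \<open>pi / 2\<close>. Both processes are read off the same Gaussian vector;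
  \<open>orth\<close> makes them uncorrelated, hence independent. The derivative in the angle is a
  positive multiple of the drift integral.\<close>

lemma gaussian_softmax_comparison:
  fixes a b :: "'i \<Rightarrow> 'k \<Rightarrow> real"
  assumes K: "finite K" and I: "finite I" "I \<noteq> {}" and \<beta>: "\<beta> > 0" and p: "0 < p" "p \<le> 1"
    and orth: "\<And>i j. i \<in> I \<Longrightarrow> j \<in> I \<Longrightarrow> (\<Sum>k\<in>K. a i k * b j k) = 0"
    and var: "\<And>i. i \<in> I \<Longrightarrow> (\<Sum>k\<in>K. a i k * a i k) = (\<Sum>k\<in>K. b i k * b i k)"
    and cov: "\<And>i j. i \<in> I \<Longrightarrow> j \<in> I \<Longrightarrow> (\<Sum>k\<in>K. b i k * b j k) \<le> (\<Sum>k\<in>K. a i k * a j k)"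
  shows "(\<integral>x. expsum K I \<beta> a x powr p \<partial>gauss_vec K) \<le> (\<integral>x. expsum K I \<beta> b x powr p \<partial>gauss_vec K)"
proof -
  \<comment> \<open>A crude bound for the interpolated coefficients \<open>c \<theta>\<close> and
    for their derivatives \<open>d \<theta>\<close>, valid at every angle since sine and cosine are
    at most 1 in absolute value.\<close>
  define B where "B = (\<Sum>i\<in>I. \<Sum>k\<in>K. \<bar>a i k\<bar> + \<bar>b i k\<bar>)"
  define c where "c \<theta> i k = sin \<theta> * a i k + cos \<theta> * b i k" for \<theta> i k
  define d where "d \<theta> i k = cos \<theta> * a i k - sin \<theta> * b i k" for \<theta> i k
  define F where "F \<theta> x = expsum K I \<beta> (c \<theta>) x powr p" for \<theta> x
  define f where "f \<theta> i x = exp (\<beta> * lin K (c \<theta> i) x) * expsum K I \<beta> (c \<theta>) x powr (p - 1)" for \<theta> i x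
  define F' where "F' \<theta> x = p * \<beta> * (\<Sum>i\<in>I. \<Sum>k\<in>K. d \<theta> i k * (x k * f \<theta> i x))" for \<theta> x
  have B: "0 \<le> B"
    unfolding B_def by (intro sum_nonneg) auto
  have ab: "\<bar>a i k\<bar> + \<bar>b i k\<bar> \<le> B" if "i \<in> I" "k \<in> K" for i k
  proof -
    have "\<bar>a i k\<bar> + \<bar>b i k\<bar> \<le> (\<Sum>k\<in>K. \<bar>a i k\<bar> + \<bar>b i k\<bar>)"
      using K that by (intro member_le_sum) auto
    also have "\<dots> \<le> B"
      unfolding B_def using I that
      by (intro member_le_sum[of i I "\<lambda>i. \<Sum>k\<in>K. \<bar>a i k\<bar> + \<bar>b i k\<bar>"] sum_nonneg) auto
    finally show ?thesis .
  qed
  have contract: "\<bar>s * u\<bar> \<le> \<bar>u\<bar>" if "\<bar>s\<bar> \<le> 1" for s u :: real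
    using mult_right_mono[OF that, of "\<bar>u\<bar>"] by (simp add: abs_mult)
  have c_le: "\<bar>c \<theta> i k\<bar> \<le> B" if "i \<in> I" "k \<in> K" for \<theta> i k
    unfolding c_def using ab[OF that] contract[of "sin \<theta>" "a i k"] contract[of "cos \<theta>" "b i k"]
    by (intro order_trans[OF abs_triangle_ineq]) simp
  have d_le: "\<bar>d \<theta> i k\<bar> \<le> B" if "i \<in> I" "k \<in> K" for \<theta> i k
    unfolding d_def using ab[OF that] contract[of "cos \<theta>" "a i k"] contract[of "sin \<theta>" "b i k"]
    by (intro order_trans[OF abs_triangle_ineq4]) simp
  interpret c: gaussian_softmax K I \<beta> p B "c \<theta>" for \<theta>
    by standard (use K I \<beta> p B c_le in auto)
  have int: "integrable (gauss_vec K) (F \<theta>)" for \<theta>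
  proof (rule integrable_gauss_vec_exp_bound[OF K])
    show "F \<theta> \<in> borel_measurable (gauss_vec K)"
      unfolding F_def by measurable
    show "\<bar>F \<theta> x\<bar> \<le> real (card I) powr p * exp (p * \<beta> * B * (\<Sum>k\<in>K. \<bar>x k\<bar>))" for x
      using c.S_powr_bound[of \<theta> x] by (simp add: F_def)
  qed
  have F': "((\<lambda>\<theta>. F \<theta> x) has_real_derivative F' \<theta> x) (at \<theta>)" for \<theta> x
  proof -
    have "((\<lambda>\<theta>. c \<theta> i k * x k) has_real_derivative d \<theta> i k * x k) (at \<theta>)" for i k
      unfolding c_def d_def by (auto intro!: derivative_eq_intros simp: algebra_simps)
    then have "((\<lambda>\<theta>. lin K (c \<theta> i) x) has_real_derivative lin K (d \<theta> i) x) (at \<theta>)" for i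
      unfolding lin_def by (intro DERIV_sum)
    then have "((\<lambda>\<theta>. exp (\<beta> * lin K (c \<theta> i) x)) has_real_derivative
        exp (\<beta> * lin K (c \<theta> i) x) * (\<beta> * lin K (d \<theta> i) x)) (at \<theta>)" for i
      by (intro DERIV_fun_exp DERIV_cmult)
    then have "((\<lambda>\<theta>. expsum K I \<beta> (c \<theta>) x) has_real_derivative
        (\<Sum>i\<in>I. exp (\<beta> * lin K (c \<theta> i) x) * (\<beta> * lin K (d \<theta> i) x))) (at \<theta>)"
      unfolding expsum_def by (intro DERIV_sum)
    from DERIV_chain2[OF has_real_derivative_powr[OF c.S_pos, where r = p] this] show ?thesis
      unfolding F_def F'_def f_def lin_def
      by (rule DERIV_cong) (simp add: sum_distrib_left sum_distrib_right mult_ac)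
  qed
  define C where "C = real (card I) powr p"
  \<comment> \<open>The right-hand side is free of \<theta>, as differentiation under the integral
    requires.\<close>
  have bound: "\<bar>F' \<theta> x\<bar> \<le> p * \<beta> * (\<Sum>i\<in>I. \<Sum>k\<in>K. B * (C * exp ((p * \<beta> * B + 1) * (\<Sum>k\<in>K. \<bar>x k\<bar>))))" for \<theta> x
  proof -
    have "\<bar>d \<theta> i k * (x k * f \<theta> i x)\<bar> \<le> B * (C * exp ((p * \<beta> * B + 1) * (\<Sum>k\<in>K. \<bar>x k\<bar>)))"
      if "i \<in> I" "k \<in> K" for i k
    proof -
      have "\<bar>f \<theta> i x\<bar> \<le> C * exp (p * \<beta> * B * (\<Sum>k\<in>K. \<bar>x k\<bar>))"
        unfolding f_def C_def using order_trans[OF c.e_S_powr_le[OF that(1)] c.S_powr_bound]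
        by (simp add: abs_mult)
      then show ?thesis
        unfolding abs_mult[of "d \<theta> i k"] using d_le[OF that] B
        by (intro mult_mono mult_component_exp_bound[OF K that(2)]) auto
    qed
    then have "\<bar>\<Sum>i\<in>I. \<Sum>k\<in>K. d \<theta> i k * (x k * f \<theta> i x)\<bar> \<le>
        (\<Sum>i\<in>I. \<Sum>k\<in>K. B * (C * exp ((p * \<beta> * B + 1) * (\<Sum>k\<in>K. \<bar>x k\<bar>))))"
      by (intro order_trans[OF sum_abs] sum_mono)
    then show ?thesis
      unfolding F'_def using p \<beta> by (simp add: abs_mult)
  qed
  have "((\<lambda>\<theta>. \<integral>x. F \<theta> x \<partial>gauss_vec K) has_real_derivative (\<integral>x. F' \<theta> x \<partial>gauss_vec K)) (at \<theta>)" for \<theta>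
  proof (rule has_real_derivative_integral[OF int _ F' bound])
    have f: "f \<theta> i \<in> borel_measurable (gauss_vec K)" for i
      unfolding f_def by measurable
    show "F' \<theta> \<in> borel_measurable (gauss_vec K)"
      unfolding F'_def
      by (intro borel_measurable_times borel_measurable_sum borel_measurable_const f
          measurable_gauss_vec_component)
    have "integrable (gauss_vec K) (\<lambda>x. exp ((p * \<beta> * B + 1) * (\<Sum>k\<in>K. \<bar>x k\<bar>)))"
      unfolding sum_distrib_left by (rule integrable_exp_sum_abs_gauss_vec[OF K])
    then show "integrable (gauss_vec K)
        (\<lambda>x. p * \<beta> * (\<Sum>i\<in>I. \<Sum>k\<in>K. B * (C * exp ((p * \<beta> * B + 1) * (\<Sum>k\<in>K. \<bar>x k\<bar>)))))"
      by (intro integrable_mult_right Bochner_Integration.integrable_sum)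
  qed
  moreover have "(\<integral>x. F' \<theta> x \<partial>gauss_vec K) \<le> 0" if "0 \<le> \<theta>" "\<theta> \<le> pi / 2" for \<theta>
  proof -
    \<comment> \<open>Orthogonality kills the terms with squared sine or cosine. What is left is the
      covariance gap of the two processes, zero for \<open>i = j\<close> by \<open>var\<close> and
      nonnegative by \<open>cov\<close>.\<close>
    have dc: "(\<Sum>k\<in>K. d \<theta> i k * c \<theta> j k) =
        sin \<theta> * cos \<theta> * ((\<Sum>k\<in>K. a i k * a j k) - (\<Sum>k\<in>K. b i k * b j k))"
      if "i \<in> I" "j \<in> I" for i j
    proof -
      have "(\<Sum>k\<in>K. d \<theta> i k * c \<theta> j k) =
          sin \<theta> * cos \<theta> * ((\<Sum>k\<in>K. a i k * a j k) - (\<Sum>k\<in>K. b i k * b j k))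
          + (cos \<theta>)\<^sup>2 * (\<Sum>k\<in>K. a i k * b j k) - (sin \<theta>)\<^sup>2 * (\<Sum>k\<in>K. a j k * b i k)"
        unfolding c_def d_def
        by (simp add: sum_distrib_left sum.distrib sum_subtractf algebra_simps power2_eq_square)
      then show ?thesis
        using orth that by simp
    qed
    have "0 \<le> sin \<theta> * cos \<theta>"
      using that by (intro mult_nonneg_nonneg sin_ge_zero cos_ge_zero) auto
    then have "(\<integral>x. (\<Sum>i\<in>I. \<Sum>k\<in>K. d \<theta> i k * (x k * f \<theta> i x)) \<partial>gauss_vec K) \<le> 0"
      unfolding f_def by (intro c.integral_drift_nonpos) (auto simp: dc var cov)
    then show ?thesis
      unfolding F'_def using p \<beta> by (simp add: mult_nonneg_nonpos)
  qed
  ultimately have "(\<integral>x. F (pi / 2) x \<partial>gauss_vec K) \<le> (\<integral>x. F 0 x \<partial>gauss_vec K)"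
    by (intro DERIV_nonpos_imp_nonincreasing[of 0 "pi / 2"]) auto
  moreover have "c (pi / 2) = a" "c 0 = b"
    by (simp_all add: c_def fun_eq_iff)
  ultimately show ?thesis
    by (simp add: F_def)
qed

text \<open>With \<open>\<beta> * p = t\<close>, replacing the exponential of \<open>t\<close> times
  the maximum by \<open>expsum\<close> to the power \<open>p\<close> costs at most the factor
  \<open>card I powr p\<close>, which tends to 1 with \<open>p\<close> going to 0. On the side of
  \<open>b\<close>, the weights \<open>w\<close> decouple the maximum into a sum over independent
  coordinates, and the integral factorizes.\<close>

lemma gaussian_max_mgf_le:
  fixes a b :: "'i \<Rightarrow> 'k \<Rightarrow> real"
  assumes K: "finite K" and I: "finite I" "I \<noteq> {}" and t: "t > 0"
    and orth: "\<And>i j. i \<in> I \<Longrightarrow> j \<in> I \<Longrightarrow> (\<Sum>k\<in>K. a i k * b j k) = 0"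
    and var: "\<And>i. i \<in> I \<Longrightarrow> (\<Sum>k\<in>K. a i k * a i k) = (\<Sum>k\<in>K. b i k * b i k)"
    and cov: "\<And>i j. i \<in> I \<Longrightarrow> j \<in> I \<Longrightarrow> (\<Sum>k\<in>K. b i k * b j k) \<le> (\<Sum>k\<in>K. a i k * a j k)"
    and w: "\<And>i k. i \<in> I \<Longrightarrow> k \<in> K \<Longrightarrow> \<bar>b i k\<bar> \<le> w k"
  shows "(\<integral>x. exp (t * (MAX i\<in>I. lin K (a i) x)) \<partial>gauss_vec K)
      \<le> (\<Prod>k\<in>K. \<integral>y. exp (t * w k * \<bar>y\<bar>) \<partial>std_gauss)" (is "?L \<le> ?R")
proof (rule LIMSEQ_le_const)
  \<comment> \<open>The comparison is used along \<open>p = 1 / Suc n\<close>, which stays in the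
    admissible range and tends to 0.\<close>
  have "(\<lambda>n. real (card I) powr (1 / real (Suc n)) * ?R) \<longlonglongrightarrow> real (card I) powr 0 * ?R"
    using I by (intro tendsto_intros LIMSEQ_Suc[OF lim_1_over_n]) (auto simp: card_gt_0_iff)
  then show "(\<lambda>n. real (card I) powr (1 / real (Suc n)) * ?R) \<longlonglongrightarrow> ?R"
    using I by simp
  show "\<exists>N. \<forall>n\<ge>N. ?L \<le> real (card I) powr (1 / real (Suc n)) * ?R"
  proof (intro exI allI impI)
    fix n :: nat
    define p where "p = 1 / real (Suc n)"
    define \<beta> where "\<beta> = t * real (Suc n)"
    have p: "0 < p" "p \<le> 1" and \<beta>: "0 < \<beta>" and \<beta>p: "\<beta> * p = t"
      using t by (auto simp: p_def \<beta>_def)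
    have exp_p: "exp (\<beta> * z) powr p = exp (t * z)" for z
      using \<beta>p by (simp add: exp_powr_real mult_ac flip: \<beta>p)
    define B where "B = (\<Sum>i\<in>I. \<Sum>k\<in>K. \<bar>a i k\<bar>)"
    have a_le: "\<bar>a i k\<bar> \<le> B" if "i \<in> I" "k \<in> K" for i k
    proof -
      have "\<bar>a i k\<bar> \<le> (\<Sum>k\<in>K. \<bar>a i k\<bar>)"
        using K that by (intro member_le_sum) auto
      also have "\<dots> \<le> B"
        unfolding B_def using I that
        by (intro member_le_sum[of i I "\<lambda>i. \<Sum>k\<in>K. \<bar>a i k\<bar>"] sum_nonneg) auto
      finally show ?thesis .
    qed
    have "0 \<le> B"
      unfolding B_def by (intro sum_nonneg) auto
    interpret a: gaussian_softmax K I \<beta> p B a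
      by standard (use K I \<beta> p a_le \<open>0 \<le> B\<close> in auto)
    have "?L \<le> (\<integral>x. expsum K I \<beta> a x powr p \<partial>gauss_vec K)"
    proof (rule integral_mono')
      show "integrable (gauss_vec K) (\<lambda>x. expsum K I \<beta> a x powr p)"
        by (rule integrable_gauss_vec_exp_bound[OF K, of _ "real (card I) powr p" "p * \<beta> * B"])
           (use a.S_powr_bound in auto)
      show "exp (t * (MAX i\<in>I. lin K (a i) x)) \<le> expsum K I \<beta> a x powr p" for x
      proof -
        have "(MAX i\<in>I. lin K (a i) x) \<in> (\<lambda>i. lin K (a i) x) ` I"
          using I by (intro Max_in) auto
        then obtain i where i: "i \<in> I" "(MAX i\<in>I. lin K (a i) x) = lin K (a i) x"
          by auto
        \<comment> \<open>The term of a maximizing index alone already gives the lower bound for the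
          exponential sum.\<close>
        show ?thesis
          unfolding i(2) exp_p[symmetric] using a.e_le_S[OF i(1)] p by (intro powr_mono2) auto
      qed
    qed simp
    also have "\<dots> \<le> (\<integral>x. expsum K I \<beta> b x powr p \<partial>gauss_vec K)"
      using K I \<beta> p orth var cov by (rule gaussian_softmax_comparison)
    also have "\<dots> \<le> (\<integral>x. real (card I) powr p * exp (\<Sum>k\<in>K. t * w k * \<bar>x k\<bar>) \<partial>gauss_vec K)"
    proof (rule integral_mono')
      show "integrable (gauss_vec K) (\<lambda>x. real (card I) powr p * exp (\<Sum>k\<in>K. t * w k * \<bar>x k\<bar>))"
        by (intro integrable_mult_right integrable_exp_sum_abs_gauss_vec K)
      fix x
      have "exp (\<beta> * lin K (b i) x) \<le> exp (\<beta> * (\<Sum>k\<in>K. w k * \<bar>x k\<bar>))" if "i \<in> I" for i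
        using lin_le[of K "b i" w x] w[OF that] \<beta> by simp
      then have "expsum K I \<beta> b x \<le> real (card I) * exp (\<beta> * (\<Sum>k\<in>K. w k * \<bar>x k\<bar>))"
        unfolding expsum_def by (rule sum_bounded_above)
      then have "expsum K I \<beta> b x powr p \<le> (real (card I) * exp (\<beta> * (\<Sum>k\<in>K. w k * \<bar>x k\<bar>))) powr p"
        using p by (intro powr_mono2) (auto simp: expsum_def intro: sum_nonneg)
      also have "\<dots> = real (card I) powr p * exp (\<Sum>k\<in>K. t * w k * \<bar>x k\<bar>)"
        by (simp add: powr_mult exp_p) (simp add: sum_distrib_left mult_ac)
      finally show "expsum K I \<beta> b x powr p \<le> real (card I) powr p * exp (\<Sum>k\<in>K. t * w k * \<bar>x k\<bar>)" .
    qed simp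
    also have "\<dots> = real (card I) powr p * ?R"
      by (simp add: integral_exp_sum_abs_gauss_vec[OF K])
    finally show "?L \<le> real (card I) powr (1 / real (Suc n)) * ?R"
      unfolding p_def .
  qed
qed

section \<open>The bilinear form on the cube\<close>

lemma exp_le_quadratic_remainder:
  fixes u :: real
  assumes "0 \<le> u"
  shows "exp u \<le> 1 + u + u\<^sup>2 * exp u"
proof -
  have "exp u * (1 - u) \<le> exp u * exp (- u)"
    using exp_ge_add_one_self[of "- u"] by (intro mult_left_mono) auto
  \<comment> \<open>This bound is then inserted into its own right-hand side to reach second
    order.\<close>
  then have 1: "exp u \<le> 1 + u * exp u"
    by (simp add: algebra_simps flip: exp_add)
  then have "u * exp u \<le> u * (1 + u * exp u)"
    using assms by (intro mult_left_mono) auto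
  with 1 show ?thesis
    by (simp add: algebra_simps power2_eq_square)
qed

text \<open>The rate 3 absorbs the remainder
  \<open>\<bar>y\<bar>\<^sup>2 * exp (s * \<bar>y\<bar>)\<close> for \<open>s \<le> 1\<close>: two
  units for the square and one for the exponential.\<close>

definition abs_mgf_const :: real where
  "abs_mgf_const = (\<integral>y. exp (3 * \<bar>y\<bar>) \<partial>std_gauss)"

text \<open>Integrating the second-order expansion of the exponential: the linear term gives the
  mean \<open>sqrt (2 / pi)\<close> of the absolute value, and \<open>1 + z \<le> exp z\<close>
  restores a form that multiplies well over coordinates.\<close>

lemma abs_mgf_le:
  assumes s: "0 \<le> s" "s \<le> 1"
  shows "(\<integral>y. exp (s * \<bar>y\<bar>) \<partial>std_gauss) \<le> exp (s * sqrt (2 / pi) + abs_mgf_const * s\<^sup>2)"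
proof -
  have int: "integrable std_gauss (\<lambda>y. \<bar>y\<bar>)"
    using integrable_std_normal_moment_abs[of 1] by (simp add: integrable_std_gauss_iff)
  have "(\<integral>y. exp (s * \<bar>y\<bar>) \<partial>std_gauss) \<le> (\<integral>y. 1 + s * \<bar>y\<bar> + s\<^sup>2 * exp (3 * \<bar>y\<bar>) \<partial>std_gauss)"
  proof (rule integral_mono)
    show "integrable std_gauss (\<lambda>y. 1 + s * \<bar>y\<bar> + s\<^sup>2 * exp (3 * \<bar>y\<bar>))"
      by (intro Bochner_Integration.integrable_add integrable_mult_right int
          integrable_exp_abs_std_gauss) simp
    fix y :: real
    have "\<bar>y\<bar> \<le> exp \<bar>y\<bar>"
      by (rule order_trans[OF _ exp_ge_add_one_self]) simp
    moreover have "s * \<bar>y\<bar> \<le> \<bar>y\<bar>"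
      using s by (simp add: mult_left_le_one_le)
    ultimately have "s\<^sup>2 * (\<bar>y\<bar>\<^sup>2 * exp (s * \<bar>y\<bar>)) \<le> s\<^sup>2 * ((exp \<bar>y\<bar>)\<^sup>2 * exp \<bar>y\<bar>)"
      by (intro mult_left_mono mult_mono power_mono) auto
    also have "(exp \<bar>y\<bar>)\<^sup>2 * exp \<bar>y\<bar> = exp (3 * \<bar>y\<bar>)"
      by (simp add: power2_eq_square flip: exp_add)
    finally have "(s * \<bar>y\<bar>)\<^sup>2 * exp (s * \<bar>y\<bar>) \<le> s\<^sup>2 * exp (3 * \<bar>y\<bar>)"
      by (simp add: power_mult_distrib mult.assoc)
    moreover have "exp (s * \<bar>y\<bar>) \<le> 1 + s * \<bar>y\<bar> + (s * \<bar>y\<bar>)\<^sup>2 * exp (s * \<bar>y\<bar>)"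
      using s by (intro exp_le_quadratic_remainder) simp
    ultimately show "exp (s * \<bar>y\<bar>) \<le> 1 + s * \<bar>y\<bar> + s\<^sup>2 * exp (3 * \<bar>y\<bar>)"
      by linarith
  qed (rule integrable_exp_abs_std_gauss)
  also have "\<dots> = 1 + (s * sqrt (2 / pi) + abs_mgf_const * s\<^sup>2)"
    using int integrable_exp_abs_std_gauss[of 3] std_gauss.prob_space
    by (simp add: abs_mgf_const_def integral_abs_std_gauss mult_ac)
  also have "\<dots> \<le> exp (s * sqrt (2 / pi) + abs_mgf_const * s\<^sup>2)"
    by (rule exp_ge_add_one_self)
  finally show ?thesis .
qed

section \<open>The normalized sign cube\<close>

lemma finite_cube: "finite (cube n)"
  unfolding cube_def by (intro finite_PiE) auto

lemma cube_nonempty: "cube n \<noteq> {}"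
  unfolding cube_def by (simp add: PiE_eq_empty_iff)

lemma abs_cube: "x \<in> cube n \<Longrightarrow> j < n \<Longrightarrow> \<bar>x j\<bar> = 1 / sqrt (real n)"
  unfolding cube_def by (drule PiE_mem[of _ _ _ j]) auto

lemma abs_cube_le_1: "x \<in> cube n \<Longrightarrow> j < n \<Longrightarrow> \<bar>x j\<bar> \<le> 1"
  using abs_cube[of x n j] by simp

lemma uminus_in_cube:
  assumes "x \<in> cube n"
  shows "(\<lambda>j\<in>{..<n}. - x j) \<in> cube n"
  unfolding cube_def restrict_PiE_iff
proof
  fix j assume "j \<in> {..<n}"
  with assms have "x j \<in> {- 1 / sqrt (real n), 1 / sqrt (real n)}"
    unfolding cube_def by (rule PiE_mem)
  then show "- x j \<in> {- 1 / sqrt (real n), 1 / sqrt (real n)}"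
    by auto
qed

lemma sum_square_cube: "x \<in> cube n \<Longrightarrow> n > 0 \<Longrightarrow> (\<Sum>j<n. x j * x j) = 1"
proof -
  assume x: "x \<in> cube n" and n: "n > 0"
  have "x j * x j = 1 / real n" if "j < n" for j
    using abs_mult_self_eq[of "x j"] abs_cube[OF x that] by simp
  then show ?thesis
    using n by simp
qed

lemma sum_mult_cube_le:
  assumes "x \<in> cube n" "x' \<in> cube n" "n > 0"
  shows "(\<Sum>j<n. x j * x' j) \<le> 1"
proof -
  have "x j * x' j \<le> 1 / real n" if "j < n" for j
    using abs_ge_self[of "x j * x' j"] abs_cube[OF assms(1) that] abs_cube[OF assms(2) that]
    by (simp add: abs_mult)
  then have "(\<Sum>j<n. x j * x' j) \<le> (\<Sum>j<n. 1 / real n)"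
    by (intro sum_mono) auto
  then show ?thesis
    using assms(3) by simp
qed

section \<open>Elementary properties of the maximum\<close>

lemma xi_p_eq_Max_image:
  "xi_p m n H = (MAX (x, y)\<in>cube n \<times> cube m. bilin m n H x y)"
  unfolding xi_p_def by (intro arg_cong[where f = Max]) auto

lemma bilin_le_xi_p: "x \<in> cube n \<Longrightarrow> y \<in> cube m \<Longrightarrow> bilin m n H x y \<le> xi_p m n H"
  unfolding xi_p_eq_Max_image using finite_cube by (intro Max_ge) auto

lemma xi_p_attained:
  obtains x y where "x \<in> cube n" "y \<in> cube m" "xi_p m n H = bilin m n H x y"
proof -
  have "xi_p m n H \<in> (\<lambda>(x, y). bilin m n H x y) ` (cube n \<times> cube m)"
    unfolding xi_p_eq_Max_image using finite_cube cube_nonempty by (intro Max_in) auto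
  with that show ?thesis
    by auto
qed

text \<open>Flipping the sign of \<open>x\<close> stays in the cube and flips the sign of the form.
  This is what makes the events for the maximum and for its square coincide later.\<close>

lemma xi_p_nonneg: "0 \<le> xi_p m n H"
proof -
  obtain x y where xy: "x \<in> cube n" "y \<in> cube m"
    using cube_nonempty by blast
  have "bilin m n H (\<lambda>j\<in>{..<n}. - x j) y = - bilin m n H x y"
    by (simp add: bilin_def sum_negf)
  then show ?thesis
    using bilin_le_xi_p[OF xy, of H] bilin_le_xi_p[OF uminus_in_cube[OF xy(1)] xy(2), of H] by simp
qed

lemma xi_p_cong:
  assumes "\<And>i j. i < m \<Longrightarrow> j < n \<Longrightarrow> H i j = H' i j"
  shows "xi_p m n H = xi_p m n H'"
proof -
  have "bilin m n H x y = bilin m n H' x y" for x y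
    using assms by (simp add: bilin_def)
  then show ?thesis
    by (simp add: xi_p_def)
qed

text \<open>Cube coordinates are at most 1 in absolute value. The estimate is crude and serves only
  integrability.\<close>

lemma xi_p_le_sum_abs: "xi_p m n H \<le> (\<Sum>(i, j)\<in>{..<m} \<times> {..<n}. \<bar>H i j\<bar>)"
proof -
  obtain x y where xy: "x \<in> cube n" "y \<in> cube m" "xi_p m n H = bilin m n H x y"
    by (rule xi_p_attained)
  have "bilin m n H x y = (\<Sum>i<m. \<Sum>j<n. y i * (H i j * x j))"
    by (simp add: bilin_def sum_distrib_left)
  also have "\<dots> \<le> (\<Sum>i<m. \<Sum>j<n. \<bar>H i j\<bar>)"
  proof (intro sum_mono)
    fix i j assume ij: "i \<in> {..<m}" "j \<in> {..<n}"
    have "y i * (H i j * x j) \<le> \<bar>y i * (H i j * x j)\<bar>"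
      by (rule abs_ge_self)
    also have "\<dots> \<le> 1 * (\<bar>H i j\<bar> * 1)"
      unfolding abs_mult using abs_cube_le_1[OF xy(1), of j] abs_cube_le_1[OF xy(2), of i] ij
      by (intro mult_mono) auto
    finally show "y i * (H i j * x j) \<le> \<bar>H i j\<bar>"
      by simp
  qed
  finally show ?thesis
    by (simp add: xy(3) sum.cartesian_product)
qed

lemma borel_measurable_xi_p:
  assumes "\<And>i j. i < m \<Longrightarrow> j < n \<Longrightarrow> (\<lambda>\<omega>. H \<omega> i j) \<in> borel_measurable M"
  shows "(\<lambda>\<omega>. xi_p m n (H \<omega>)) \<in> borel_measurable M"
  unfolding xi_p_eq_Max_image
proof (rule borel_measurable_Max)
  show "finite (cube n \<times> cube m)"
    using finite_cube by simp
  show "(\<lambda>\<omega>. case z of (x, y) \<Rightarrow> bilin m n (H \<omega>) x y) \<in> borel_measurable M" for z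
    unfolding bilin_def case_prod_beta using assms
    by (intro borel_measurable_sum borel_measurable_times borel_measurable_const) auto
qed

section \<open>The two Gaussian processes on the extended index grid\<close>

lemma sum_grid:
  "(\<Sum>k\<in>{..m} \<times> {..n}. f k) =
    (\<Sum>i<m. \<Sum>j<n. f (i, j)) + (\<Sum>i<m. f (i, n)) + (\<Sum>j<n. f (m, j)) + f (m, n)"
  for f :: "nat \<times> nat \<Rightarrow> 'a :: comm_monoid_add"
proof -
  have "(\<Sum>k\<in>{..m} \<times> {..n}. f k) = (\<Sum>i<Suc m. \<Sum>j<Suc n. f (i, j))"
    by (simp only: sum.cartesian_product lessThan_Suc_atMost case_prod_eta)
  also have "\<dots> = (\<Sum>i<m. \<Sum>j<n. f (i, j)) + (\<Sum>i<m. f (i, n)) + (\<Sum>j<n. f (m, j)) + f (m, n)"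
    by (simp only: sum.lessThan_Suc sum.distrib add_ac)
  finally show ?thesis .
qed

text \<open>
  The Gaussian variables of the comparison are indexed by \<open>{..m} \<times> {..n}\<close>: the entries \<open>(i, j)\<close> with
  \<open>i < m\<close> and \<open>j < n\<close> are those of the matrix, the last column and the last row are the
  independent vectors \<open>g\<close> and \<open>h\<close> of the decoupled process, and \<open>(m, n)\<close> is the extra scalar
  that equalizes the variances.
\<close>

definition bilin_coeff :: "nat \<Rightarrow> nat \<Rightarrow> (nat \<Rightarrow> real) \<times> (nat \<Rightarrow> real) \<Rightarrow> nat \<times> nat \<Rightarrow> real" where
  "bilin_coeff m n = (\<lambda>(x, y) (i, j).
     if i < m \<and> j < n then y i * x j else if i = m \<and> j = n then 1 else 0)"

definition decoupled_coeff :: "nat \<Rightarrow> nat \<Rightarrow> (nat \<Rightarrow> real) \<times> (nat \<Rightarrow> real) \<Rightarrow> nat \<times> nat \<Rightarrow> real" where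
  "decoupled_coeff m n = (\<lambda>(x, y) (i, j).
     if i < m \<and> j = n then y i else if i = m \<and> j < n then x j else 0)"

text \<open>For points of the cube these are the absolute values of the coefficients in
  \<open>decoupled_coeff\<close>, whatever the signs; this is why the decoupled maximum is a sum of
  absolute values.\<close>

definition decoupled_weight :: "nat \<Rightarrow> nat \<Rightarrow> nat \<times> nat \<Rightarrow> real" where
  "decoupled_weight m n = (\<lambda>(i, j).
     if i < m \<and> j = n then 1 / sqrt (real m) else if i = m \<and> j < n then 1 / sqrt (real n) else 0)"

lemma sum_mult_sum_cube:
  "(\<Sum>i<m. \<Sum>j<n. y i * x j * (y' i * x' j)) = (\<Sum>i<m. y i * y' i) * (\<Sum>j<n. x j * x' j :: real)"
  by (simp add: sum_product mult_ac)

lemma lin_bilin_coeff: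
  "lin ({..m} \<times> {..n}) (bilin_coeff m n (x, y)) g = bilin m n (\<lambda>i j. g (i, j)) x y + g (m, n)"
  by (simp add: lin_def sum_grid bilin_coeff_def bilin_def sum_distrib_left mult_ac)

text \<open>The extra scalar enters every linear form with coefficient 1 and so leaves the maximum
  as a common shift.\<close>

lemma MAX_lin_bilin_coeff:
  "(MAX z\<in>cube n \<times> cube m. lin ({..m} \<times> {..n}) (bilin_coeff m n z) g) =
    xi_p m n (\<lambda>i j. g (i, j)) + g (m, n)"
proof -
  have "(\<lambda>z. lin ({..m} \<times> {..n}) (bilin_coeff m n z) g) =
      (\<lambda>z. (case z of (x, y) \<Rightarrow> bilin m n (\<lambda>i j. g (i, j)) x y) + g (m, n))"
    by (simp add: fun_eq_iff lin_bilin_coeff)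
  moreover have "finite (cube n \<times> cube m)" "cube n \<times> cube m \<noteq> {}"
    using finite_cube cube_nonempty by auto
  ultimately show ?thesis
    unfolding xi_p_eq_Max_image by (simp only:) (rule Max_add_commute)
qed

section \<open>Exponential moments of the maximum over the Gaussian grid\<close>

lemma exp_xi_p_bound:
  assumes "0 \<le> t"
  shows "exp (t * xi_p m n (\<lambda>i j. g (i, j))) \<le> exp (t * (\<Sum>k\<in>{..m} \<times> {..n}. \<bar>g k\<bar>))"
proof -
  have "xi_p m n (\<lambda>i j. g (i, j)) \<le> (\<Sum>k\<in>{..<m} \<times> {..<n}. \<bar>g k\<bar>)"
    using xi_p_le_sum_abs[of m n "\<lambda>i j. g (i, j)"] by (simp add: case_prod_beta)
  also have "\<dots> \<le> (\<Sum>k\<in>{..m} \<times> {..n}. \<bar>g k\<bar>)"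
    by (intro sum_mono2) auto
  finally show ?thesis
    using assms by (simp add: mult_left_mono)
qed

lemma borel_measurable_xi_p_gauss_vec:
  assumes "{..<m} \<times> {..<n} \<subseteq> K"
  shows "(\<lambda>g. xi_p m n (\<lambda>i j. g (i, j))) \<in> borel_measurable (gauss_vec K)"
  using assms by (intro borel_measurable_xi_p measurable_gauss_vec_component) auto

lemma borel_measurable_exp_xi_p_gauss_vec:
  "(\<lambda>g. exp (t * xi_p m n (\<lambda>i j. g (i, j)))) \<in> borel_measurable (gauss_vec ({..m} \<times> {..n}))"
  by (intro borel_measurable_exp[THEN measurable_compose_rev] borel_measurable_times
      borel_measurable_const borel_measurable_xi_p_gauss_vec) auto

lemma integrable_exp_xi_p_gauss_vec:
  assumes "0 \<le> t"
  shows "integrable (gauss_vec ({..m} \<times> {..n})) (\<lambda>g. exp (t * xi_p m n (\<lambda>i j. g (i, j))))"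
  by (rule integrable_gauss_vec_exp_bound[where C = 1 and c = t, OF _ borel_measurable_exp_xi_p_gauss_vec])
     (use exp_xi_p_bound[OF assms] in auto)

lemma gauss_mgf_xi_p_plus_le:
  assumes mn: "0 < m" "0 < n" and t: "0 < t" "t \<le> 1"
  shows "(\<integral>g. exp (t * (xi_p m n (\<lambda>i j. g (i, j)) + g (m, n))) \<partial>gauss_vec ({..m} \<times> {..n}))
    \<le> exp (t * ((sqrt (real m) + sqrt (real n)) * sqrt (2 / pi)) + 2 * abs_mgf_const * t\<^sup>2)"
proof -
  let ?K = "{..m} \<times> {..n}" and ?w = "decoupled_weight m n"
  have weight: "0 \<le> ?w k" "?w k \<le> 1" for k
    using mn by (cases k; simp add: decoupled_weight_def)+
  have "(\<integral>g. exp (t * (xi_p m n (\<lambda>i j. g (i, j)) + g (m, n))) \<partial>gauss_vec ?K) =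
      (\<integral>g. exp (t * (MAX z\<in>cube n \<times> cube m. lin ?K (bilin_coeff m n z) g)) \<partial>gauss_vec ?K)"
    by (simp only: MAX_lin_bilin_coeff)
  also have "\<dots> \<le> (\<Prod>k\<in>?K. \<integral>y. exp (t * ?w k * \<bar>y\<bar>) \<partial>std_gauss)"
  proof (rule gaussian_max_mgf_le)
    show "finite ?K" "finite (cube n \<times> cube m)" "cube n \<times> cube m \<noteq> {}"
      using finite_cube cube_nonempty by auto
    fix z z' assume "z \<in> cube n \<times> cube m" "z' \<in> cube n \<times> cube m"
    then obtain x y x' y' where z: "z = (x, y)" "z' = (x', y')"
      and xy: "x \<in> cube n" "y \<in> cube m" "x' \<in> cube n" "y' \<in> cube m"
      by auto
    show "(\<Sum>k\<in>?K. bilin_coeff m n z k * decoupled_coeff m n z' k) = 0"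
      by (simp add: z sum_grid bilin_coeff_def decoupled_coeff_def)
    have a: "(\<Sum>k\<in>?K. bilin_coeff m n (x, y) k * bilin_coeff m n (x', y') k) =
        (\<Sum>i<m. y i * y' i) * (\<Sum>j<n. x j * x' j) + 1" for x y x' y'
      by (simp add: sum_grid bilin_coeff_def sum_mult_sum_cube)
    have b: "(\<Sum>k\<in>?K. decoupled_coeff m n (x, y) k * decoupled_coeff m n (x', y') k) =
        (\<Sum>i<m. y i * y' i) + (\<Sum>j<n. x j * x' j)" for x y x' y'
      by (simp add: sum_grid decoupled_coeff_def)
    show "(\<Sum>k\<in>?K. bilin_coeff m n z k * bilin_coeff m n z k) =
        (\<Sum>k\<in>?K. decoupled_coeff m n z k * decoupled_coeff m n z k)"
      unfolding z a b using xy mn by (simp add: sum_square_cube)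
    \<comment> \<open>This product is exactly the covariance gap \<open>1 + u * v - (u + v)\<close>,
      where \<open>u\<close> and \<open>v\<close> are the two inner products.\<close>
    have "0 \<le> (1 - (\<Sum>i<m. y i * y' i)) * (1 - (\<Sum>j<n. x j * x' j))"
      using sum_mult_cube_le xy mn by (intro mult_nonneg_nonneg) auto
    then show "(\<Sum>k\<in>?K. decoupled_coeff m n z k * decoupled_coeff m n z' k)
        \<le> (\<Sum>k\<in>?K. bilin_coeff m n z k * bilin_coeff m n z' k)"
      unfolding z a b by (simp add: algebra_simps)
    show "\<bar>decoupled_coeff m n z k\<bar> \<le> ?w k" for k
      using xy by (cases k) (simp add: z decoupled_coeff_def decoupled_weight_def abs_cube)
  qed fact
  also have "\<dots> \<le> (\<Prod>k\<in>?K. exp (t * ?w k * sqrt (2 / pi) + abs_mgf_const * (t * ?w k)\<^sup>2))"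
    using t weight by (intro prod_mono conjI abs_mgf_le) (auto simp: mult_le_one)
  also have "\<dots> = exp (t * ((\<Sum>k\<in>?K. ?w k) * sqrt (2 / pi)) + abs_mgf_const * (t\<^sup>2 * (\<Sum>k\<in>?K. (?w k)\<^sup>2)))"
    by (subst exp_sum[symmetric]) (simp_all add: sum.distrib sum_distrib_left sum_distrib_right mult_ac power_mult_distrib)
  \<comment> \<open>There are \<open>m\<close> weights \<open>1 / sqrt m\<close> and
    \<open>n\<close> weights \<open>1 / sqrt n\<close>. Their squares sum to \<open>1 + 1\<close>,
    so the quadratic error does not grow with the dimensions.\<close>
  also have "(\<Sum>k\<in>?K. ?w k) = sqrt (real m) + sqrt (real n)"
    by (simp add: sum_grid decoupled_weight_def real_div_sqrt)
  also have "(\<Sum>k\<in>?K. (?w k)\<^sup>2) = 2"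
    using mn by (simp add: sum_grid decoupled_weight_def power_divide)
  finally show ?thesis
    by (simp add: mult_ac)
qed

text \<open>Jensen's inequality in the extra scalar: an independent centered summand can only
  increase an exponential moment, so the scalar may be dropped from the comparison.\<close>

lemma gauss_mgf_xi_p_le_plus:
  assumes t: "0 < t"
  shows "(\<integral>g. exp (t * xi_p m n (\<lambda>i j. g (i, j))) \<partial>gauss_vec ({..m} \<times> {..n}))
    \<le> (\<integral>g. exp (t * (xi_p m n (\<lambda>i j. g (i, j)) + g (m, n))) \<partial>gauss_vec ({..m} \<times> {..n}))"
proof -
  let ?K = "{..m} \<times> {..n}" and ?f = "\<lambda>g. exp (t * xi_p m n (\<lambda>i j. g (i, j)))"
  have K: "finite ?K" "(m, n) \<in> ?K"
    by auto
  have bound: "\<bar>?f g\<bar> \<le> 1 * exp (t * (\<Sum>k\<in>?K. \<bar>g k\<bar>))" for g :: "nat \<times> nat \<Rightarrow> real"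
    using exp_xi_p_bound[of t m n g] t by simp
  note meas = borel_measurable_exp_xi_p_gauss_vec[of t m n]
  have comp: "(\<lambda>g. g (m, n)) \<in> borel_measurable (gauss_vec ?K)"
    by (rule measurable_gauss_vec_component) auto
  have const: "?f (g((m, n) := s)) = ?f g" for g s
    by (intro arg_cong[where f = "\<lambda>z. exp (t * z)"] xi_p_cong) auto
  \<comment> \<open>\<open>g (m, n)\<close> is centered and independent of the matrix, so the linear term in
    \<open>exp (t * g (m, n)) \<ge> 1 + t * g (m, n)\<close> drops out; integration by parts expresses this.\<close>
  have "(\<integral>g. g (m, n) * ?f g \<partial>gauss_vec ?K) = (\<integral>g. 0 \<partial>gauss_vec ?K)"
    by (rule gauss_vec_integration_by_parts[OF K meas _ _ _ bound]) (simp_all add: const del: fun_upd_apply)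
  then have zero: "(\<integral>g. g (m, n) * ?f g \<partial>gauss_vec ?K) = 0"
    by simp
  note int_f = integrable_exp_xi_p_gauss_vec[OF less_imp_le[OF t]]
  note int_gf = integrable_gauss_vec_exp_bound[OF K(1) borel_measurable_times[OF comp meas]
      mult_component_exp_bound[OF K bound]]
  have "(\<integral>g. ?f g \<partial>gauss_vec ?K) = (\<integral>g. ?f g + t * (g (m, n) * ?f g) \<partial>gauss_vec ?K)"
    by (simp add: Bochner_Integration.integral_add[OF int_f integrable_mult_right[OF int_gf]] zero)
  also have "\<dots> \<le> (\<integral>g. exp (t * (xi_p m n (\<lambda>i j. g (i, j)) + g (m, n))) \<partial>gauss_vec ?K)"
  proof (rule integral_mono)
    show "integrable (gauss_vec ?K) (\<lambda>g. ?f g + t * (g (m, n) * ?f g))"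
      by (intro Bochner_Integration.integrable_add int_f integrable_mult_right[OF int_gf])
    show "integrable (gauss_vec ?K) (\<lambda>g. exp (t * (xi_p m n (\<lambda>i j. g (i, j)) + g (m, n))))"
    proof (rule integrable_gauss_vec_exp_bound[OF K(1)])
      have "(\<lambda>g. ?f g * exp (t * g (m, n))) \<in> borel_measurable (gauss_vec ?K)"
        by (intro borel_measurable_times meas
            borel_measurable_exp[THEN measurable_compose_rev] borel_measurable_const comp)
      then show "(\<lambda>g. exp (t * (xi_p m n (\<lambda>i j. g (i, j)) + g (m, n)))) \<in> borel_measurable (gauss_vec ?K)"
        by (simp add: distrib_left exp_add)
      fix g :: "nat \<times> nat \<Rightarrow> real"
      have "g (m, n) \<le> (\<Sum>k\<in>?K. \<bar>g k\<bar>)"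
        by (rule order_trans[OF abs_ge_self member_le_sum[OF K(2), of "\<lambda>k. \<bar>g k\<bar>"]]) auto
      then have "exp (t * g (m, n)) \<le> exp (t * (\<Sum>k\<in>?K. \<bar>g k\<bar>))"
        using t by simp
      then have "?f g * exp (t * g (m, n)) \<le> exp (t * (\<Sum>k\<in>?K. \<bar>g k\<bar>)) * exp (t * (\<Sum>k\<in>?K. \<bar>g k\<bar>))"
        using bound[of g] by (intro mult_mono) auto
      then show "\<bar>exp (t * (xi_p m n (\<lambda>i j. g (i, j)) + g (m, n)))\<bar> \<le> 1 * exp ((2 * t) * (\<Sum>k\<in>?K. \<bar>g k\<bar>))"
        by (simp add: distrib_left flip: exp_add)
    qed
    fix g :: "nat \<times> nat \<Rightarrow> real"
    have "?f g * (1 + t * g (m, n)) \<le> ?f g * exp (t * g (m, n))"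
      by (intro mult_left_mono exp_ge_add_one_self) simp
    then show "?f g + t * (g (m, n) * ?f g) \<le> exp (t * (xi_p m n (\<lambda>i j. g (i, j)) + g (m, n)))"
      by (simp add: algebra_simps exp_add)
  qed
  finally show ?thesis .
qed

lemma gauss_mgf_xi_p_le:
  assumes "0 < m" "0 < n" "0 < t" "t \<le> 1"
  shows "(\<integral>g. exp (t * xi_p m n (\<lambda>i j. g (i, j))) \<partial>gauss_vec ({..m} \<times> {..n}))
    \<le> exp (t * ((sqrt (real m) + sqrt (real n)) * sqrt (2 / pi)) + 2 * abs_mgf_const * t\<^sup>2)"
  by (rule order_trans[OF gauss_mgf_xi_p_le_plus[OF assms(3)] gauss_mgf_xi_p_plus_le[OF assms]])

section \<open>Transfer to an arbitrary probability space\<close>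

lemma iid_std_normal_matrix_distr_xi_p:
  assumes iid: "iid_std_normal_matrix M m n H" and mn: "0 < m" "0 < n"
  defines "\<xi> \<equiv> \<lambda>\<omega>. xi_p m n (\<lambda>i j. H i j \<omega>)"
  shows "\<xi> \<in> borel_measurable M"
    and "distr M borel \<xi> = distr (gauss_vec ({..m} \<times> {..n})) borel (\<lambda>g. xi_p m n (\<lambda>i j. g (i, j)))"
proof -
  define J where "J = {..<m} \<times> {..<n}"
  define X where "X = (\<lambda>(i, j). H i j)"
  define \<Phi> where "\<Phi> = (\<lambda>g :: nat \<times> nat \<Rightarrow> real. xi_p m n (\<lambda>i j. g (i, j)))"
  interpret M: prob_space M
    using iid by (simp add: iid_std_normal_matrix_def)
  have indep: "M.indep_vars (\<lambda>_. borel) X J"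
    using iid by (simp add: iid_std_normal_matrix_def X_def J_def)
  have dist: "distributed M lborel (X k) std_normal_density" if "k \<in> J" for k
    using iid that by (auto simp: iid_std_normal_matrix_def X_def J_def)
  have X [measurable]: "X k \<in> borel_measurable M" if "k \<in> J" for k
    using distributed_measurable[OF dist[OF that]] by simp
  then show meas: "\<xi> \<in> borel_measurable M"
    unfolding \<xi>_def by (intro borel_measurable_xi_p) (force simp: X_def J_def)
  have \<Phi> [measurable]: "\<Phi> \<in> borel_measurable (gauss_vec K)" if "J \<subseteq> K" for K
    using that unfolding \<Phi>_def J_def by (rule borel_measurable_xi_p_gauss_vec)
  have \<Phi>_restrict: "\<Phi> (restrict g J) = \<Phi> g" for g
    unfolding \<Phi>_def by (rule xi_p_cong) (simp add: J_def)
  have distr_X: "distr M borel (X k) = std_gauss" if "k \<in> J" for k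
  proof -
    have "distr M borel (X k) = distr M lborel (X k)"
      by (rule distr_cong) auto
    also have "\<dots> = std_gauss"
      using distributed_distr_eq_density[OF dist[OF that]] by (simp add: std_gauss_def)
    finally show ?thesis .
  qed
  have sets: "sets (Pi\<^sub>M J (\<lambda>_. borel)) = sets (gauss_vec J)"
    unfolding gauss_vec_def by (rule sets_PiM_cong) auto
  have "(\<lambda>\<omega>. \<lambda>k\<in>J. X k \<omega>) \<in> measurable M (Pi\<^sub>M J (\<lambda>_. borel))"
    by (intro measurable_restrict X)
  then have restr: "(\<lambda>\<omega>. \<lambda>k\<in>J. X k \<omega>) \<in> measurable M (gauss_vec J)"
    by (simp only: measurable_cong_sets[OF refl sets])
  have "J \<noteq> {}"
    using mn by (auto simp: J_def)
  \<comment> \<open>Independence says that the joint law of the entries is the product of their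
    laws.\<close>
  then have "distr M (Pi\<^sub>M J (\<lambda>_. borel)) (\<lambda>\<omega>. \<lambda>k\<in>J. X k \<omega>) = Pi\<^sub>M J (\<lambda>k. distr M borel (X k))"
    using M.indep_vars_iff_distr_eq_PiM'[where I = J and X = X and M' = "\<lambda>_. borel"] indep X by auto
  also have "\<dots> = gauss_vec J"
    unfolding gauss_vec_def by (rule PiM_cong) (auto simp: distr_X)
  finally have distr_J: "distr M (gauss_vec J) (\<lambda>\<omega>. \<lambda>k\<in>J. X k \<omega>) = gauss_vec J"
    using distr_cong[OF refl sets] by metis
  have "\<xi> = \<Phi> \<circ> (\<lambda>\<omega>. \<lambda>k\<in>J. X k \<omega>)"
    by (simp add: fun_eq_iff \<Phi>_restrict) (simp add: \<xi>_def \<Phi>_def X_def)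
  then have "distr M borel \<xi> = distr (distr M (gauss_vec J) (\<lambda>\<omega>. \<lambda>k\<in>J. X k \<omega>)) borel \<Phi>"
    by (simp add: distr_distr[OF \<Phi> restr])
  also have "\<dots> = distr (gauss_vec J) borel \<Phi>"
    by (simp only: distr_J)
  also have "\<dots> = distr (gauss_vec ({..m} \<times> {..n})) borel \<Phi>"
  \<comment> \<open>The matrix block is a marginal of the full grid, and \<open>\<Phi>\<close>
    depends only on the block, so the auxiliary coordinates do not change its law.\<close>
  proof -
    interpret product_prob_space "\<lambda>_. std_gauss" "{..m} \<times> {..n}"
      by standard
    have JK: "J \<subseteq> {..m} \<times> {..n}"
      by (auto simp: J_def)
    have restrict: "(\<lambda>g. restrict g J) \<in> measurable (gauss_vec ({..m} \<times> {..n})) (gauss_vec J)"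
      unfolding gauss_vec_def by (rule measurable_restrict_subset[OF JK])
    have "gauss_vec J = distr (gauss_vec ({..m} \<times> {..n})) (gauss_vec J) (\<lambda>g. restrict g J)"
      unfolding gauss_vec_def by (rule distr_restrict[OF JK]) auto
    then have "distr (gauss_vec J) borel \<Phi> =
        distr (distr (gauss_vec ({..m} \<times> {..n})) (gauss_vec J) (\<lambda>g. restrict g J)) borel \<Phi>"
      by (rule arg_cong[where f = "\<lambda>N. distr N borel \<Phi>"])
    also have "\<dots> = distr (gauss_vec ({..m} \<times> {..n})) borel \<Phi>"
      by (simp add: distr_distr[OF \<Phi> restrict] comp_def \<Phi>_restrict)
    finally show ?thesis .
  qed
  finally show "distr M borel \<xi> = distr (gauss_vec ({..m} \<times> {..n})) borel (\<lambda>g. xi_p m n (\<lambda>i j. g (i, j)))"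
    by (simp only: \<Phi>_def)
qed

lemma
  assumes iid: "iid_std_normal_matrix M m n H" and mn: "0 < m" "0 < n" and t: "0 < t" "t \<le> 1"
  shows integrable_exp_xi_p: "integrable M (\<lambda>\<omega>. exp (t * xi_p m n (\<lambda>i j. H i j \<omega>)))"
    and mgf_xi_p_le: "(\<integral>\<omega>. exp (t * xi_p m n (\<lambda>i j. H i j \<omega>)) \<partial>M)
      \<le> exp (t * ((sqrt (real m) + sqrt (real n)) * sqrt (2 / pi)) + 2 * abs_mgf_const * t\<^sup>2)"
proof -
  note * = iid_std_normal_matrix_distr_xi_p[OF iid mn]
  have \<Phi>: "(\<lambda>g. xi_p m n (\<lambda>i j. g (i, j))) \<in> borel_measurable (gauss_vec ({..m} \<times> {..n}))"
    by (rule borel_measurable_xi_p_gauss_vec) auto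
  have e: "(\<lambda>z. exp (t * z)) \<in> borel_measurable borel"
    by measurable
  show "integrable M (\<lambda>\<omega>. exp (t * xi_p m n (\<lambda>i j. H i j \<omega>)))"
    using integrable_exp_xi_p_gauss_vec[of t m n] t
    by (simp only: integrable_distr_eq[OF *(1) e, symmetric] integrable_distr_eq[OF \<Phi> e, symmetric] *(2))
  have "(\<integral>\<omega>. exp (t * xi_p m n (\<lambda>i j. H i j \<omega>)) \<partial>M) =
      (\<integral>g. exp (t * xi_p m n (\<lambda>i j. g (i, j))) \<partial>gauss_vec ({..m} \<times> {..n}))"
    by (simp only: integral_distr[OF *(1) e, symmetric] integral_distr[OF \<Phi> e, symmetric] *(2))
  then show "(\<integral>\<omega>. exp (t * xi_p m n (\<lambda>i j. H i j \<omega>)) \<partial>M)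
      \<le> exp (t * ((sqrt (real m) + sqrt (real n)) * sqrt (2 / pi)) + 2 * abs_mgf_const * t\<^sup>2)"
    using gauss_mgf_xi_p_le[OF mn t] by simp
qed

section \<open>Expectation and upper tail of the maximum\<close>

lemma integrable_xi_p:
  assumes "iid_std_normal_matrix M m n H" "0 < m" "0 < n"
  shows "integrable M (\<lambda>\<omega>. xi_p m n (\<lambda>i j. H i j \<omega>))"
proof (rule Bochner_Integration.integrable_bound)
  show "integrable M (\<lambda>\<omega>. exp (1 * xi_p m n (\<lambda>i j. H i j \<omega>)))"
    by (rule integrable_exp_xi_p[OF assms]) auto
  have le: "\<bar>z\<bar> \<le> \<bar>exp (1 * z)\<bar>" if "0 \<le> z" for z :: real
    using order_trans[OF _ exp_ge_add_one_self, of z z] that by simp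
  show "AE \<omega> in M. norm (xi_p m n (\<lambda>i j. H i j \<omega>)) \<le> norm (exp (1 * xi_p m n (\<lambda>i j. H i j \<omega>)))"
    unfolding real_norm_def by (intro AE_I2 le xi_p_nonneg)
qed (rule iid_std_normal_matrix_distr_xi_p[OF assms])

text \<open>From \<open>1 + z \<le> exp z\<close> the mean is bounded by the difference quotient at
  0 of the exponential-moment bound \<open>\<phi>\<close>, for every small positive
  \<open>t\<close>. The limit is the derivative at 0, to which the quadratic term contributes
  nothing.\<close>

lemma expectation_xi_p_le:
  assumes iid: "iid_std_normal_matrix M m n H" and mn: "0 < m" "0 < n"
  shows "(\<integral>\<omega>. xi_p m n (\<lambda>i j. H i j \<omega>) \<partial>M) \<le> (sqrt (real m) + sqrt (real n)) * sqrt (2 / pi)"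
proof -
  interpret prob_space M
    using iid by (simp add: iid_std_normal_matrix_def)
  define A where "A = (sqrt (real m) + sqrt (real n)) * sqrt (2 / pi)"
  define \<phi> where "\<phi> t = exp (t * A + 2 * abs_mgf_const * t\<^sup>2)" for t
  let ?\<xi> = "\<lambda>\<omega>. xi_p m n (\<lambda>i j. H i j \<omega>)"
  have le: "expectation ?\<xi> \<le> (\<phi> t - \<phi> 0) / (t - 0)" if t: "0 < t" "t \<le> 1" for t
  proof -
    have "1 + t * expectation ?\<xi> = (\<integral>\<omega>. 1 + t * ?\<xi> \<omega> \<partial>M)"
      using integrable_xi_p[OF assms] by (simp add: prob_space)
    also have "\<dots> \<le> expectation (\<lambda>\<omega>. exp (t * ?\<xi> \<omega>))"
      using integrable_xi_p[OF assms]
      by (intro integral_mono integrable_exp_xi_p[OF assms t] exp_ge_add_one_self) auto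
    also have "\<dots> \<le> \<phi> t"
      unfolding \<phi>_def A_def by (rule mgf_xi_p_le[OF assms t])
    finally show ?thesis
      using t by (simp add: \<phi>_def field_simps)
  qed
  have "(\<phi> has_real_derivative A) (at 0)"
    unfolding \<phi>_def by (auto intro!: derivative_eq_intros)
  then have "((\<lambda>t. (\<phi> t - \<phi> 0) / (t - 0)) \<longlongrightarrow> A) (at_right 0)"
    unfolding has_field_derivative_iff by (rule filterlim_mono) (auto intro: at_le)
  moreover have "\<forall>\<^sub>F t in at_right 0. expectation ?\<xi> \<le> (\<phi> t - \<phi> 0) / (t - 0)"
    using le by (auto simp: eventually_at_right_field intro!: exI[of _ 1])
  ultimately show ?thesis
    unfolding A_def[symmetric] by (rule tendsto_lowerbound) simp
qed

text \<open>Markov's inequality for the exponential of the maximum at \<open>t = 1\<close>. The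
  fixed parameter suffices because the excess of the threshold over the mean bound will grow like
  \<open>sqrt n\<close> while the error constant stays fixed.\<close>

lemma prob_xi_p_le:
  assumes iid: "iid_std_normal_matrix M m n H" and mn: "0 < m" "0 < n"
  shows "1 - exp ((sqrt (real m) + sqrt (real n)) * sqrt (2 / pi) + 2 * abs_mgf_const - u)
    \<le> measure M {\<omega> \<in> space M. xi_p m n (\<lambda>i j. H i j \<omega>) \<le> u}"
proof -
  interpret prob_space M
    using iid by (simp add: iid_std_normal_matrix_def)
  let ?\<xi> = "\<lambda>\<omega>. xi_p m n (\<lambda>i j. H i j \<omega>)"
  have \<xi> [measurable]: "?\<xi> \<in> borel_measurable M"
    by (rule iid_std_normal_matrix_distr_xi_p[OF assms])
  have sets: "{\<omega> \<in> space M. ?\<xi> \<omega> \<le> u} \<in> events"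
    by measurable
  have "1 - prob {\<omega> \<in> space M. ?\<xi> \<omega> \<le> u} = prob (space M - {\<omega> \<in> space M. ?\<xi> \<omega> \<le> u})"
    using prob_compl[OF sets] by simp
  also have "\<dots> \<le> prob {\<omega> \<in> space M. exp u \<le> exp (1 * ?\<xi> \<omega>)}"
    by (intro finite_measure_mono) auto
  also have "\<dots> \<le> expectation (\<lambda>\<omega>. exp (1 * ?\<xi> \<omega>)) / exp u"
    by (rule integral_Markov_inequality_measure[where A = "space M"])
       (auto intro!: integrable_exp_xi_p[OF assms, of 1, simplified])
  also have "\<dots> \<le> exp (1 * ((sqrt (real m) + sqrt (real n)) * sqrt (2 / pi)) + 2 * abs_mgf_const * 1\<^sup>2) / exp u"
    by (intro divide_right_mono mgf_xi_p_le[OF assms]) auto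
  also have "\<dots> = exp ((sqrt (real m) + sqrt (real n)) * sqrt (2 / pi) + 2 * abs_mgf_const - u)"
    by (simp add: exp_diff)
  finally show ?thesis
    by simp
qed

section \<open>Passage to the limit along admissible dimensions\<close>

theorem lemma6:
  fixes \<alpha> \<epsilon>1m \<epsilon>1n \<epsilon>5g :: real
    and m :: "nat \<Rightarrow> nat"
    and M :: "nat \<Rightarrow> 'a measure"
    and H :: "nat \<Rightarrow> nat \<Rightarrow> nat \<Rightarrow> 'a \<Rightarrow> real"
    and xi_u :: "nat \<Rightarrow> real"
  assumes "\<alpha> > 0"
    and "\<And>n. n \<in> admissible \<alpha> \<Longrightarrow> real (m n) = \<alpha> * real n"
    and "\<And>n. n \<in> admissible \<alpha> \<Longrightarrow> iid_std_normal_matrix (M n) (m n) n (H n)"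
    and "\<epsilon>1m > 0" and "\<epsilon>1n > 0" and "\<epsilon>5g > 0"
    and "\<And>n. n \<in> admissible \<alpha> \<Longrightarrow>
           (1 + \<epsilon>1m) * sqrt \<alpha> * sqrt (2 / pi) + (1 + \<epsilon>1n) * sqrt (2 / pi) + \<epsilon>5g
             < xi_u n / sqrt (real n)"
  defines "\<xi> \<equiv> \<lambda>n \<omega>. xi_p (m n) n (\<lambda>i j. H n i j \<omega>)"
  shows "((\<lambda>n. measure (M n) {\<omega> \<in> space (M n). \<xi> n \<omega> \<le> xi_u n}) \<longlongrightarrow> 1)
           (admissible_at_top \<alpha>)
       \<and> ((\<lambda>n. measure (M n) {\<omega> \<in> space (M n). (\<xi> n \<omega>)\<^sup>2 \<le> (xi_u n)\<^sup>2}) \<longlongrightarrow> 1)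
           (admissible_at_top \<alpha>)
       \<and> (\<forall>n \<in> admissible \<alpha>.
            integrable (M n) (\<xi> n) \<and>
            (\<integral>\<omega>. \<xi> n \<omega> \<partial>M n) / sqrt (real n) \<le> (sqrt \<alpha> + 1) * sqrt (2 / pi))"
proof -
  define A where "A n = (sqrt (real (m n)) + sqrt (real n)) * sqrt (2 / pi)" for n
  have n_pos: "0 < n" if "n \<in> admissible \<alpha>" for n
    using that by (simp add: admissible_def)
  have m_pos: "0 < m n" if "n \<in> admissible \<alpha>" for n
    using assms(1) assms(2)[OF that] n_pos[OF that] by (metis mult_pos_pos of_nat_0_less_iff)
  have A_eq: "A n = sqrt (real n) * ((sqrt \<alpha> + 1) * sqrt (2 / pi))" if "n \<in> admissible \<alpha>" for n
    by (simp add: A_def assms(2)[OF that] real_sqrt_mult algebra_simps)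
  \<comment> \<open>Since \<open>\<epsilon>1m\<close> and \<open>\<epsilon>1n\<close> are positive,
    replacing them by 0 keeps the inequality; \<open>\<epsilon>5g\<close> leaves a margin of order
    \<open>sqrt n\<close> above the mean bound \<open>A n\<close>.\<close>
  have xi_u: "A n + \<epsilon>5g * sqrt (real n) \<le> xi_u n" if n: "n \<in> admissible \<alpha>" for n
  proof -
    have "1 * (sqrt \<alpha> * sqrt (2 / pi)) \<le> (1 + \<epsilon>1m) * (sqrt \<alpha> * sqrt (2 / pi))"
      "1 * sqrt (2 / pi) \<le> (1 + \<epsilon>1n) * sqrt (2 / pi)"
      using assms(1,4,5) by (intro mult_right_mono; simp)+
    then have "(sqrt \<alpha> + 1) * sqrt (2 / pi) + \<epsilon>5g \<le> xi_u n / sqrt (real n)"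
      using assms(7)[OF n] by (simp add: algebra_simps)
    then show ?thesis
      using n_pos[OF n] unfolding A_eq[OF n] by (simp add: le_divide_eq algebra_simps)
  qed
  have prob: "((\<lambda>n. measure (M n) {\<omega> \<in> space (M n). \<xi> n \<omega> \<le> xi_u n}) \<longlongrightarrow> 1) (admissible_at_top \<alpha>)"
  proof (rule tendsto_sandwich)
    \<comment> \<open>The margin beats the constant \<open>2 * abs_mgf_const\<close>, so the
      exponent tends to minus infinity.\<close>
    have "((\<lambda>n. 1 - exp (2 * abs_mgf_const - \<epsilon>5g * sqrt (real n))) \<longlongrightarrow> 1) sequentially"
      using assms(6) by real_asymp
    then show "((\<lambda>n. 1 - exp (2 * abs_mgf_const - \<epsilon>5g * sqrt (real n))) \<longlongrightarrow> 1) (admissible_at_top \<alpha>)"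
      unfolding admissible_at_top_def by (rule tendsto_mono[OF inf_le1])
    show "\<forall>\<^sub>F n in admissible_at_top \<alpha>. 1 - exp (2 * abs_mgf_const - \<epsilon>5g * sqrt (real n))
        \<le> measure (M n) {\<omega> \<in> space (M n). \<xi> n \<omega> \<le> xi_u n}"
      unfolding admissible_at_top_def eventually_inf_principal
    proof (intro always_eventually allI impI)
      fix n assume n: "n \<in> admissible \<alpha>"
      have "1 - exp (2 * abs_mgf_const - \<epsilon>5g * sqrt (real n)) \<le> 1 - exp (A n + 2 * abs_mgf_const - xi_u n)"
        using xi_u[OF n] by simp
      also have "\<dots> \<le> measure (M n) {\<omega> \<in> space (M n). \<xi> n \<omega> \<le> xi_u n}"
        unfolding A_def \<xi>_def by (rule prob_xi_p_le[OF assms(3)[OF n] m_pos[OF n] n_pos[OF n]])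
      finally show "1 - exp (2 * abs_mgf_const - \<epsilon>5g * sqrt (real n))
        \<le> measure (M n) {\<omega> \<in> space (M n). \<xi> n \<omega> \<le> xi_u n}" .
    qed
    show "\<forall>\<^sub>F n in admissible_at_top \<alpha>. measure (M n) {\<omega> \<in> space (M n). \<xi> n \<omega> \<le> xi_u n} \<le> 1"
      unfolding admissible_at_top_def eventually_inf_principal
      using assms(3) by (auto simp: iid_std_normal_matrix_def intro!: always_eventually prob_space.prob_le_1)
  qed simp
  \<comment> \<open>Squaring is monotone here because both the maximum and the threshold are
    nonnegative, the latter by its margin over \<open>A n\<close>.\<close>
  have square_le_iff: "(\<xi> n \<omega>)\<^sup>2 \<le> (xi_u n)\<^sup>2 \<longleftrightarrow> \<xi> n \<omega> \<le> xi_u n" if n: "n \<in> admissible \<alpha>" for n \<omega>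
  proof -
    have "0 \<le> A n + \<epsilon>5g * sqrt (real n)"
      using assms(6) by (simp add: A_def)
    then have "0 \<le> xi_u n"
      using xi_u[OF n] by simp
    moreover have "0 \<le> \<xi> n \<omega>"
      unfolding \<xi>_def by (rule xi_p_nonneg)
    ultimately show ?thesis
      by (simp add: power_mono_iff)
  qed
  have "\<forall>\<^sub>F n in admissible_at_top \<alpha>. measure (M n) {\<omega> \<in> space (M n). (\<xi> n \<omega>)\<^sup>2 \<le> (xi_u n)\<^sup>2} =
      measure (M n) {\<omega> \<in> space (M n). \<xi> n \<omega> \<le> xi_u n}"
    unfolding admissible_at_top_def eventually_inf_principal
    by (intro always_eventually allI impI) (simp add: square_le_iff)
  then have "((\<lambda>n. measure (M n) {\<omega> \<in> space (M n). (\<xi> n \<omega>)\<^sup>2 \<le> (xi_u n)\<^sup>2}) \<longlongrightarrow> 1) (admissible_at_top \<alpha>)"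
    using prob by (simp add: tendsto_cong)
  moreover have "integrable (M n) (\<xi> n) \<and>
      (\<integral>\<omega>. \<xi> n \<omega> \<partial>M n) / sqrt (real n) \<le> (sqrt \<alpha> + 1) * sqrt (2 / pi)" if n: "n \<in> admissible \<alpha>" for n
  proof
    show "integrable (M n) (\<xi> n)"
      unfolding \<xi>_def by (rule integrable_xi_p[OF assms(3)[OF n] m_pos[OF n] n_pos[OF n]])
    have "(\<integral>\<omega>. \<xi> n \<omega> \<partial>M n) \<le> A n"
      unfolding \<xi>_def A_def by (rule expectation_xi_p_le[OF assms(3)[OF n] m_pos[OF n] n_pos[OF n]])
    then show "(\<integral>\<omega>. \<xi> n \<omega> \<partial>M n) / sqrt (real n) \<le> (sqrt \<alpha> + 1) * sqrt (2 / pi)"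
      using n_pos[OF n] unfolding A_eq[OF n] by (simp add: divide_le_eq mult_ac)
  qed
  ultimately show ?thesis
    using prob by blast
qed

end
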